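(* Let $d\ge2$ be an integer and $0\le\alpha<2$. There are constants $c_{d,\alpha}>0$ (depending only on $d$ and $\alpha$) and $b_d>0$ (depending only on $d$), such that for arbitrarily large $M$ (i.e. for an unbounded set of $M>0$) there is a trigonometric polynomial $G_M$ on $\mathbb{T}^d$ with $\|G_M\|_{L^2(\mathbb{T}^d)}=1$ and Fourier support in $\{n\in\mathbb{Z}^d:M\le|n|\le2M\}$ such that $$\left|\left\{x\in\mathbb{T}^d:\ \sup_{0<t<M^{-\alpha}}|e^{it\Delta}G_M(x)|\ge c_{d,\alpha}M^{\frac{d}{d+2}\left(1-\frac{\alpha}{2}\right)}\right\}\right|\ge b_d.$$
   Context: $\mathbb{T}^d=(\mathbb{R}/2\pi\mathbb{Z})^d$ carries normalized Haar measure $(2\pi)^{-d}\,dx$, used both for $|A|$ (the measure of a set $A$) and for the $L^2$ norm. Fourier coefficients are $\widehat f(n)=(2\pi)^{-d}\int_{[0,2\pi)^d}f(x)e^{-in\cdot x}\,dx$, $n\in\mathbb{Z}^d$; the Fourier support of $f$ is $\{n:\widehat f(n)\neq0\}$; $|n|$ is the Euclidean length. A trigonometric polynomial is a finite complex linear combination of the functions $x\mapsto e^{in\cdot x}$, $n\in\mathbb{Z}^d$, and for such $f$ one sets $e^{it\Delta}f(x)=\sum_{n\in\mathbb{Z}^d}\widehat f(n)e^{i(n\cdot x-t|n|^2)}$. *)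

theory Defs
  imports "HOL-Analysis.Analysis"
begin

text \<open>
  Functions on the torus $(\mathbb{R}/2\pi\mathbb{Z})^d$ are functions on \<open>real^'n\<close>, with
  \<open>d = CARD('n)\<close>, that are $2\pi$-periodic in every coordinate. Trigonometric polynomials are
  periodic by their form, so the torus itself only enters through its normalized Haar measure,
  carried by the fundamental domain $[0,2\pi)^d$.
\<close>

definition torus_box :: "(real ^ 'n) set" where
  "torus_box = {x. \<forall>i. 0 \<le> x $ i \<and> x $ i < 2 * pi}"

definition torus_measure :: "(real ^ 'n) measure" where
  "torus_measure = uniform_measure lborel torus_box"

definition freq :: "int ^ 'n \<Rightarrow> real ^ 'n" where
  "freq n = (\<chi> i. of_int (n $ i))"

definition trig_polynomial :: "(real ^ 'n \<Rightarrow> complex) \<Rightarrow> bool" where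
  "trig_polynomial f \<longleftrightarrow>
     (\<exists>(S :: (int ^ 'n) set) a. finite S \<and> f = (\<lambda>x. \<Sum>n\<in>S. a n * cis (freq n \<bullet> x)))"

definition fourier_coeff :: "(real ^ 'n \<Rightarrow> complex) \<Rightarrow> int ^ 'n \<Rightarrow> complex" where
  "fourier_coeff f n = (LINT x|torus_measure. f x * cis (- (freq n \<bullet> x)))"

definition fourier_support :: "(real ^ 'n \<Rightarrow> complex) \<Rightarrow> (int ^ 'n) set" where
  "fourier_support f = {n. fourier_coeff f n \<noteq> 0}"

definition torus_L2_norm :: "(real ^ 'n \<Rightarrow> complex) \<Rightarrow> real" where
  "torus_L2_norm f = sqrt (LINT x|torus_measure. (norm (f x))\<^sup>2)"

text \<open>
  The free evolution $e^{it\Delta}f(x)$. For a trigonometric polynomial only finitely many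
  terms of the sum are nonzero.
\<close>

definition schroedinger :: "real \<Rightarrow> (real ^ 'n \<Rightarrow> complex) \<Rightarrow> real ^ 'n \<Rightarrow> complex" where
  "schroedinger t f x =
     (\<Sum>\<^sub>\<infinity>n. fourier_coeff f n * cis (freq n \<bullet> x - t * (norm (freq n))\<^sup>2))"

end

theory Submission
  imports Defs "HOL-Number_Theory.Cong"
begin

text \<open>
  Throughout, \<open>d = CARD('n)\<close> and \<open>p\<close> is a large odd prime for which \<open>-1\<close> is a square modulo \<open>p\<^sup>2\<close>.

  The data are exponential sums over a piece of a coset \<open>V + \<Lambda>\<close> of the lattice
  \<open>\<Lambda> = {a \<xi> + p w | p dvd w \<bullet> \<xi>}\<close>, where \<open>\<xi>\<close> is an integer vector with \<open>p\<^sup>2 dvd \<xi> \<bullet> \<xi>\<close>. Any two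
  vectors of \<open>\<Lambda>\<close> have inner product divisible by \<open>p\<^sup>2\<close>. Hence at the times \<open>2\<pi>j/p\<^sup>2\<close> the quadratic
  phase \<open>t|n|\<^sup>2\<close> is, modulo \<open>2\<pi>\<close>, an affine function of \<open>n \<in> V + \<Lambda>\<close>, and the evolved sum is completely
  coherent at all points \<open>2\<pi>u/p\<^sup>2\<close> with \<open>u \<in> 2jV + \<Lambda>\<close>. If \<open>V \<bullet> \<xi>\<close> is prime to \<open>p\<close>, these sets exhaust, as
  \<open>j\<close> varies, all integer vectors \<open>u\<close> that are congruent modulo \<open>p\<close> to a combination of \<open>\<xi>\<close> and \<open>V\<close>
  (\<open>exists_focusing_time\<close>). For Gauss sums over the full lattice, by contrast, all times with the same
  denominator focus on the same points.

  The plane spanned by \<open>\<xi>\<close> and \<open>V\<close> modulo \<open>p\<close> has \<open>p\<^sup>2\<close> elements. A count of the bad choices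
  (\<open>exists_separated_plane\<close>) shows that \<open>\<xi>\<close> and \<open>V\<close> may be chosen so that it contains no nonzero vector
  with entries smaller than \<open>Q\<close>, where \<open>Q\<close> is of order \<open>p powr (1 - 2/d)\<close>. Then the cubes of side \<open>Q\<close> at
  the points of the plane are disjoint and fill a proportion \<open>p\<^sup>2 Q^d / p^d\<close> of the torus, which is bounded
  below. The sum remains coherent on these cubes as long as the vectors of \<open>\<Lambda>\<close> in use have entries of size
  at most a small multiple of \<open>p\<^sup>2/Q\<close>, that is, of order \<open>p powr (1 + 2/d)\<close>. As \<open>\<Lambda>\<close> has index at most
  \<open>p^d\<close>, there are at least of the order of \<open>(p\<^sup>2/Q)^d / p^d\<close> such vectors (\<open>exists_short_null_vectors\<close>),
  which is of order \<open>p\<^sup>2\<close>. After normalization in \<open>L\<^sup>2\<close> the height is of order \<open>p\<close>, and this is the power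
  \<open>d/(d+2)\<close> of the frequency scale \<open>M\<^sub>1\<close>, of order \<open>p powr (1 + 2/d)\<close>.

  Finally, multiplying all frequencies by an integer \<open>\<kappa>\<close> rescales time by \<open>1/\<kappa>\<^sup>2\<close> and changes neither
  the heights nor the measures. With \<open>\<kappa> powr (2 - \<alpha>)\<close> of the order of \<open>M\<^sub>1 powr \<alpha>\<close> all focusing times lie
  below \<open>(\<kappa> M\<^sub>1) powr (-\<alpha>)\<close> (\<open>exists_dilation_factor\<close>), and expressing the height through \<open>M = \<kappa> M\<^sub>1\<close>
  gives the factor \<open>1 - \<alpha>/2\<close> in the exponent.
\<close>

section \<open>Isotropic vectors modulo a prime square\<close>

text \<open>
  Integer vectors are handled as functions on the index type, so that they can be counted with
  \<open>PiE\<close>. Their inner product is \<open>idot\<close>.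
\<close>

definition idot :: "('n::finite \<Rightarrow> int) \<Rightarrow> ('n \<Rightarrow> int) \<Rightarrow> int" where
  "idot u v = (\<Sum>i\<in>UNIV. u i * v i)"

lemma idot_commute: "idot u v = idot v u"
  by (simp add: idot_def mult.commute)

lemma idot_lincomb: "idot (\<lambda>i. a * u i + b * v i) w = a * idot u w + b * idot v w"
  by (simp add: idot_def sum.distrib sum_distrib_left algebra_simps)

lemma idot_lincomb_right: "idot w (\<lambda>i. a * u i + b * v i) = a * idot w u + b * idot w v"
  by (simp add: idot_def sum.distrib sum_distrib_left algebra_simps)

lemma dvd_idot: "(\<And>i. m dvd u i) \<Longrightarrow> m dvd idot u v"
  by (simp add: idot_def dvd_sum)

lemma eq_if_dvd_diff:
  fixes a b p :: int
  assumes "p dvd a - b" "a \<in> {0..<p}" "b \<in> {0..<p}"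
  shows "a = b"
proof -
  have "a mod p = b mod p"
    using assms(1) by (simp add: mod_eq_dvd_iff)
  then show ?thesis
    using assms(2,3) by simp
qed

text \<open>
  A line modulo \<open>p\<close> through an isotropic vector can avoid any given set \<open>W\<close> of fewer than \<open>p^(d-2)\<close>
  vectors that are nonzero modulo \<open>p\<close>. The isotropic vectors are parametrized by \<open>\<tau>\<close> with \<open>d - 2\<close> free entries as
  \<open>\<xi> = (1 - s, -\<iota>(1 + s), 2\<tau>)\<close> with \<open>s = |\<tau>|\<^sup>2\<close>. These vectors satisfy \<open>\<xi>\<^sub>1 + \<iota>\<xi>\<^sub>2 = 2\<close> modulo \<open>p\<close>, so that each
  \<open>u \<in> W\<close> lies on at most one of the lines: the multiplier \<open>a\<close> and then \<open>\<tau>\<close> are determined by \<open>u\<close>.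
\<close>

lemma exists_isotropic_line:
  fixes p \<iota> :: int and W :: "('n::finite \<Rightarrow> int) set"
  assumes p: "prime p" "p > 2" and iota: "p^2 dvd \<iota>^2 + 1"
    and d: "CARD('n) \<ge> 2"
    and W: "finite W" "\<And>u. u \<in> W \<Longrightarrow> \<exists>i. \<not> p dvd u i"
    and card: "card W < nat p ^ (CARD('n) - 2)"
  obtains \<xi> where "p^2 dvd idot \<xi> \<xi>" "\<exists>k. \<not> p dvd \<xi> k"
    "\<And>u a. u \<in> W \<Longrightarrow> \<exists>i. \<not> p dvd a * \<xi> i - u i"
proof -
  obtain i1 i2 :: 'n where i12: "i1 \<noteq> i2"
    using d by (metis card_2_iff' ex_card iso_tuple_UNIV_I)
  define T where "T = UNIV - {i1, i2}"
  define P where "P = T \<rightarrow>\<^sub>E {0..<p}"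
  define s where "s = (\<lambda>\<tau>::'n \<Rightarrow> int. \<Sum>k\<in>T. (\<tau> k)^2)"
  define X where "X = (\<lambda>\<tau> i. if i = i1 then 1 - s \<tau> else if i = i2 then - \<iota> * (1 + s \<tau>) else 2 * \<tau> i)"
  have cardT: "card T = CARD('n) - 2"
    using i12 by (simp add: T_def card_Diff_subset)
  have cardP: "card P = nat p ^ (CARD('n) - 2)"
    by (simp add: P_def card_funcsetE cardT)
  have p2: "\<not> p dvd 2"
    using p by (meson not_le zdvd_imp_le zero_less_numeral)
  have UN: "UNIV = insert i1 (insert i2 T)"
    by (auto simp: T_def)
  have notin: "i1 \<notin> T" "i2 \<notin> T"
    by (auto simp: T_def)
  have XT: "X \<tau> k = 2 * \<tau> k" if "k \<in> T" for \<tau> k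
    using that notin by (auto simp: X_def)
  have X1: "X \<tau> i1 = 1 - s \<tau>" and X2: "X \<tau> i2 = - \<iota> * (1 + s \<tau>)" for \<tau>
    using i12 by (auto simp: X_def)
  have XX: "idot (X \<tau>) (X \<tau>) = (\<iota>^2 + 1) * (1 + s \<tau>)^2" for \<tau>
  proof -
    have "idot (X \<tau>) (X \<tau>) = (\<Sum>i\<in>insert i1 (insert i2 T). X \<tau> i * X \<tau> i)"
      unfolding idot_def by (subst UN) simp
    also have "\<dots> = X \<tau> i1 * X \<tau> i1 + (X \<tau> i2 * X \<tau> i2 + (\<Sum>i\<in>T. X \<tau> i * X \<tau> i))"
      using i12 notin by simp
    also have "(\<Sum>i\<in>T. X \<tau> i * X \<tau> i) = 4 * s \<tau>"
      unfolding s_def sum_distrib_left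
      by (intro sum.cong) (auto simp: XT power2_eq_square)
    finally show ?thesis
      by (simp add: X1 X2 power2_eq_square algebra_simps)
  qed
  have pi: "p dvd \<iota>^2 + 1"
    using iota by (meson dvd_trans dvd_power pos2)
  have lin: "p dvd (X \<tau> i1 + \<iota> * X \<tau> i2) - 2" for \<tau>
  proof -
    have "(X \<tau> i1 + \<iota> * X \<tau> i2) - 2 = - ((\<iota>^2 + 1) * (1 + s \<tau>))"
      by (simp add: X1 X2 power2_eq_square algebra_simps)
    then show ?thesis
      using pi by simp
  qed
  have "\<exists>\<tau>\<in>P. \<forall>u\<in>W. \<forall>a. \<exists>i. \<not> p dvd a * X \<tau> i - u i"
  proof (rule ccontr)
    assume "\<not> ?thesis"
    then have "\<forall>\<tau>\<in>P. \<exists>u. u \<in> W \<and> (\<exists>a. \<forall>i. p dvd a * X \<tau> i - u i)"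
      by blast
    from bchoice[OF this] obtain U where U: "\<And>\<tau>. \<tau> \<in> P \<Longrightarrow> U \<tau> \<in> W \<and> (\<exists>a. \<forall>i. p dvd a * X \<tau> i - U \<tau> i)"
      by blast
    have "inj_on U P"
    proof (rule inj_onI)
      fix \<tau> \<sigma> assume mem: "\<tau> \<in> P" "\<sigma> \<in> P" and eq: "U \<tau> = U \<sigma>"
      obtain a where a: "\<And>i. p dvd a * X \<tau> i - U \<tau> i"
        using U mem by blast
      obtain b where b: "\<And>i. p dvd b * X \<sigma> i - U \<tau> i"
        using U mem eq by metis
      define L where "L = U \<tau> i1 + \<iota> * U \<tau> i2"
      have key: "p dvd 2 * c - L" if "\<And>i. p dvd c * X \<rho> i - U \<tau> i" for c \<rho>
      proof -
        have "2 * c - L = (c * X \<rho> i1 - U \<tau> i1) + \<iota> * (c * X \<rho> i2 - U \<tau> i2)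
            - c * ((X \<rho> i1 + \<iota> * X \<rho> i2) - 2)"
          by (simp add: L_def algebra_simps)
        then show ?thesis
          using that[of i1] that[of i2] lin[of \<rho>] by simp
      qed
      have "p dvd 2 * (a - b)"
        using dvd_diff[OF key[OF a] key[OF b]] by (simp add: algebra_simps)
      then have ab: "p dvd a - b"
        using p p2 prime_dvd_mult_iff by blast
      have na: "\<not> p dvd a"
      proof
        assume "p dvd a"
        then have "p dvd U \<tau> i" for i
          using a[of i] by (metis dvd_diff_commute dvd_mult2 dvd_diffD1 dvd_diff_right_iff)
        then show False
          using W(2) U mem by blast
      qed
      have "\<tau> k = \<sigma> k" if k: "k \<in> T" for k
      proof -
        have "p dvd (a * X \<tau> k - U \<tau> k) - (b * X \<sigma> k - U \<tau> k) - (a - b) * X \<sigma> k"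
          using a b ab by (meson dvd_diff dvd_mult2)
        then have "p dvd 2 * (a * (\<tau> k - \<sigma> k))"
          by (simp add: XT[OF k] algebra_simps)
        then have "p dvd \<tau> k - \<sigma> k"
          using p p2 na prime_dvd_mult_iff by blast
        then show ?thesis
          using mem k by (intro eq_if_dvd_diff[of p]) (auto simp: P_def)
      qed
      then show "\<tau> = \<sigma>"
        using mem by (auto simp: P_def intro: PiE_ext)
    qed
    then have "card P \<le> card W"
      using U W(1) by (intro card_inj_on_le[of U]) auto
    then show False
      using card cardP by simp
  qed
  then obtain \<tau> where \<tau>: "\<And>u a. u \<in> W \<Longrightarrow> \<exists>i. \<not> p dvd a * X \<tau> i - u i"
    by blast
  have "\<exists>k. \<not> p dvd X \<tau> k"
  proof (rule ccontr)
    assume "\<not> ?thesis"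
    then have "p dvd (X \<tau> i1 + \<iota> * X \<tau> i2) - ((X \<tau> i1 + \<iota> * X \<tau> i2) - 2)"
      by (intro dvd_diff dvd_add dvd_mult lin) auto
    then show False
      using p2 by simp
  qed
  moreover have "p^2 dvd idot (X \<tau>) (X \<tau>)"
    using iota by (simp add: XX)
  ultimately show ?thesis
    using \<tau> that by blast
qed

text \<open>
  Likewise the isotropic line can be extended to a plane avoiding \<open>W\<close>. A vector \<open>v\<close> is bad if it is
  orthogonal to \<open>\<xi>\<close> modulo \<open>p\<close>, which happens at most \<open>p^(d-1)\<close> times, or if \<open>a \<xi> + b v = u\<close> modulo \<open>p\<close>
  with \<open>u \<in> W\<close>; then \<open>b\<close> is invertible because the line avoids \<open>W\<close>, so \<open>v\<close> is determined by \<open>(a, b, u)\<close>.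
\<close>

lemma exists_transversal_vector:
  fixes p :: int and W :: "('n::finite \<Rightarrow> int) set"
  assumes p: "prime p" and xi: "\<not> p dvd \<xi> k"
    and W: "finite W" "\<And>u a. u \<in> W \<Longrightarrow> \<exists>i. \<not> p dvd a * \<xi> i - u i"
    and card: "nat p ^ (CARD('n) - 1) + (nat p)^2 * card W < nat p ^ CARD('n)"
  obtains v where "\<And>i. v i \<in> {0..<p}" "\<not> p dvd idot v \<xi>"
    "\<And>u a b. u \<in> W \<Longrightarrow> \<exists>i. \<not> p dvd a * \<xi> i + b * v i - u i"
proof -
  define V where "V = (UNIV :: 'n set) \<rightarrow>\<^sub>E {0..<p}"
  define V1 where "V1 = {v \<in> V. p dvd idot v \<xi>}"
  define V2 where "V2 = {v \<in> V. \<exists>u\<in>W. \<exists>a b. \<forall>i. p dvd a * \<xi> i + b * v i - u i}"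
  have pp: "p > 0" using p by (simp add: prime_gt_0_int)
  have finV: "finite V" by (auto simp: V_def intro: finite_PiE)
  have cardV: "card V = nat p ^ CARD('n)"
    by (simp add: V_def card_funcsetE)
  have "card V1 \<le> card ((UNIV - {k}) \<rightarrow>\<^sub>E {0..<p})"
  proof (rule card_inj_on_le[of "\<lambda>v. restrict v (UNIV - {k})"])
    show "inj_on (\<lambda>v. restrict v (UNIV - {k})) V1"
    proof (rule inj_onI)
      fix v w assume v: "v \<in> V1" and w: "w \<in> V1"
        and eq: "restrict v (UNIV - {k}) = restrict w (UNIV - {k})"
      have eqi: "v i = w i" if "i \<noteq> k" for i
        using fun_cong[OF eq, of i] that by simp
      have "idot v \<xi> - idot w \<xi> = (\<Sum>i\<in>UNIV. (v i - w i) * \<xi> i)"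
        by (simp add: idot_def sum_subtractf algebra_simps)
      also have "\<dots> = (\<Sum>i\<in>{k}. (v i - w i) * \<xi> i)"
        by (rule sum.mono_neutral_right) (auto simp: eqi)
      finally have "p dvd (v k - w k) * \<xi> k"
        using v w by (simp add: V1_def flip: dvd_diff)
          (metis dvd_diff)
      then have "p dvd v k - w k"
        using p xi prime_dvd_mult_iff by blast
      then have "v k = w k"
        using v w by (intro eq_if_dvd_diff[of p]) (auto simp: V1_def V_def)
      then show "v = w"
        using eqi by (metis ext)
    qed
  qed (auto simp: V1_def V_def PiE_iff intro!: finite_PiE split: if_splits)
  also have "\<dots> = nat p ^ (CARD('n) - 1)"
    by (simp add: card_funcsetE card_Diff_subset)
  finally have c1: "card V1 \<le> nat p ^ (CARD('n) - 1)" .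
  have "\<forall>v\<in>V2. \<exists>f. fst f \<in> {0..<p} \<and> fst (snd f) \<in> {0..<p} \<and> snd (snd f) \<in> W \<and>
      (\<forall>i. p dvd fst f * \<xi> i + fst (snd f) * v i - snd (snd f) i)"
  proof
    fix v assume "v \<in> V2"
    then obtain u a b where u: "u \<in> W" and d: "\<And>i. p dvd a * \<xi> i + b * v i - u i"
      by (auto simp: V2_def)
    have "p dvd (a mod p) * \<xi> i + (b mod p) * v i - u i" for i
    proof -
      have "(a mod p) * \<xi> i + (b mod p) * v i - u i =
          a * \<xi> i + b * v i - u i - p * (a div p * \<xi> i + b div p * v i)"
        by (simp add: minus_div_mult_eq_mod[symmetric] algebra_simps)
      then show ?thesis
        using d[of i] by (metis dvd_diff dvd_triv_left)
    qed
    then show "\<exists>f. fst f \<in> {0..<p} \<and> fst (snd f) \<in> {0..<p} \<and> snd (snd f) \<in> W \<and>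
      (\<forall>i. p dvd fst f * \<xi> i + fst (snd f) * v i - snd (snd f) i)"
      using u pp by (intro exI[of _ "(a mod p, b mod p, u)"]) auto
  qed
  from bchoice[OF this] obtain F where F: "\<And>v. v \<in> V2 \<Longrightarrow> fst (F v) \<in> {0..<p} \<and> fst (snd (F v)) \<in> {0..<p} \<and> snd (snd (F v)) \<in> W \<and>
      (\<forall>i. p dvd fst (F v) * \<xi> i + fst (snd (F v)) * v i - snd (snd (F v)) i)"
    by blast
  have "card V2 \<le> card ({0..<p} \<times> {0..<p} \<times> W)"
  proof (rule card_inj_on_le[of F])
    show "inj_on F V2"
    proof (rule inj_onI)
      fix v w assume v: "v \<in> V2" and w: "w \<in> V2" and eq: "F v = F w"
      obtain a b u where F': "F v = (a, b, u)"
        by (metis prod_cases3)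
      have u: "u \<in> W" and d1: "\<And>i. p dvd a * \<xi> i + b * v i - u i"
        and d2: "\<And>i. p dvd a * \<xi> i + b * w i - u i"
        using F[OF v] F[OF w] F' eq by auto
      have nb: "\<not> p dvd b"
      proof
        assume "p dvd b"
        then have "p dvd (a * \<xi> i + b * v i - u i) - b * v i" for i
          using d1 by (meson dvd_diff dvd_mult2)
        then show False
          using W(2)[OF u, of a] by (simp add: algebra_simps)
      qed
      have "v i = w i" for i
      proof -
        have "p dvd b * (v i - w i)"
          using dvd_diff[OF d1[of i] d2[of i]] by (simp add: algebra_simps)
        then have "p dvd v i - w i"
          using p nb prime_dvd_mult_iff by blast
        then show ?thesis
          using v w by (intro eq_if_dvd_diff[of p]) (auto simp: V2_def V_def)
      qed
      then show "v = w" by auto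
    qed
    show "F ` V2 \<subseteq> {0..<p} \<times> {0..<p} \<times> W"
    proof (rule image_subsetI)
      fix v assume "v \<in> V2"
      from F[OF this] show "F v \<in> {0..<p} \<times> {0..<p} \<times> W"
        by (simp add: mem_Times_iff)
    qed
  qed (use W in auto)
  also have "\<dots> = (nat p)^2 * card W"
    by (simp add: card_cartesian_product power2_eq_square)
  finally have c2: "card V2 \<le> (nat p)^2 * card W" .
  have "card (V1 \<union> V2) < card V"
    using card_Un_le[of V1 V2] c1 c2 card cardV by linarith
  then have "\<not> V \<subseteq> V1 \<union> V2"
    using finV by (metis (no_types, lifting) V1_def V2_def card_mono finite_Un finite_subset
        linorder_not_le mem_Collect_eq subsetI)
  then obtain v where "v \<in> V" "v \<notin> V1" "v \<notin> V2"
    by blast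
  then show ?thesis
    by (intro that[of v]) (auto simp: V_def V1_def V2_def)
qed

section \<open>Planes without short vectors\<close>

lemma le_of_short_box:
  fixes P Q d :: nat
  assumes "d > 0" "P > 0" "Q \<ge> 1" "2 * ((2 * Q - 1) ^ d - 1) \<le> P ^ (d - 2)"
  shows "Q \<le> P"
proof (rule ccontr)
  assume "\<not> Q \<le> P"
  then have "P ^ d < Q ^ d"
    using assms(1) by (intro power_strict_mono) auto
  also have "Q ^ d \<le> (2 * Q - 1) ^ d"
    using assms by (intro power_mono) auto
  finally have "2 * P ^ d \<le> P ^ (d - 2)"
    using assms(4) by linarith
  also have "\<dots> \<le> P ^ d"
    using assms(2) by (intro power_increasing) auto
  finally show False
    using assms(2) by simp
qed

text \<open>
  The last conclusion says that the translates of the plane spanned by \<open>\<xi>\<close> and \<open>v\<close> modulo \<open>p\<close> by the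
  vectors \<open>r\<close> of a cube of side \<open>Q\<close> are pairwise disjoint. The condition on \<open>Q\<close> asks that there be at most
  \<open>p^(d-2) / 2\<close> nonzero differences of such \<open>r\<close>.
\<close>

lemma exists_separated_plane:
  fixes p \<iota> :: int and Q :: nat
  assumes p: "prime p" "p > 2" and iota: "p^2 dvd \<iota>^2 + 1"
    and d: "CARD('n::finite) \<ge> 2"
    and Q: "Q \<ge> 1" "2 * ((2 * Q - 1) ^ CARD('n) - 1) \<le> nat p ^ (CARD('n) - 2)"
  obtains \<xi> v :: "'n::finite \<Rightarrow> int" and k
  where "p^2 dvd idot \<xi> \<xi>" "\<not> p dvd \<xi> k" "\<And>i. v i \<in> {0..<p}" "\<not> p dvd idot v \<xi>"
    "\<And>a b r r'. (\<And>i. r i \<in> {0..<int Q}) \<Longrightarrow> (\<And>i. r' i \<in> {0..<int Q}) \<Longrightarrow>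
       (\<And>i. p dvd a * \<xi> i + b * v i + r i - r' i) \<Longrightarrow> p dvd a \<and> p dvd b \<and> r = r'"
proof -
  define P where "P = nat p"
  define W where "W = ((UNIV :: 'n set) \<rightarrow>\<^sub>E {- (int Q - 1)..int Q - 1}) - {\<lambda>_. 0}"
  have P3: "P > 2" using p by (simp add: P_def)
  have QP: "int Q \<le> p"
    using le_of_short_box[OF _ _ Q, of] p by simp
  have finW: "finite W"
    by (auto simp: W_def intro!: finite_PiE)
  have "card W = card ((UNIV :: 'n set) \<rightarrow>\<^sub>E {- (int Q - 1)..int Q - 1}) - 1"
    unfolding W_def using Q(1) by (intro card_Diff_singleton) auto
  also have "\<dots> = (2 * Q - 1) ^ CARD('n) - 1"
  proof -
    have "nat (1 + (int Q - 1) + (int Q - 1)) = 2 * Q - 1"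
      using Q(1) by linarith
    then show ?thesis
      by (simp add: card_funcsetE algebra_simps)
  qed
  finally have cardW: "card W = (2 * Q - 1) ^ CARD('n) - 1" .
  have W_ndvd: "\<exists>i. \<not> p dvd u i" if "u \<in> W" for u
  proof -
    obtain i where i: "u i \<noteq> 0"
      using \<open>u \<in> W\<close> by (auto simp: W_def fun_eq_iff)
    have "u i \<in> {- (int Q - 1)..int Q - 1}"
      using \<open>u \<in> W\<close> by (auto simp: W_def PiE_iff)
    then have "\<bar>u i\<bar> < p"
      using QP by auto
    then have "\<not> p dvd u i"
      using i by (metis abs_of_pos dvd_imp_le_int less_le_trans not_less p(2) zero_less_numeral order.strict_trans)
    then show ?thesis by blast
  qed
  have pos: "0 < P ^ (CARD('n) - 2)"
    using P3 by simp
  have less1: "card W < nat p ^ (CARD('n) - 2)"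
    using Q(2) pos unfolding cardW P_def by linarith
  obtain \<xi> :: "'n \<Rightarrow> int" where xi: "p^2 dvd idot \<xi> \<xi>" "\<exists>k. \<not> p dvd \<xi> k"
    "\<And>u a. u \<in> W \<Longrightarrow> \<exists>i. \<not> p dvd a * \<xi> i - u i"
    using exists_isotropic_line[OF p iota d finW W_ndvd less1] by blast
  then obtain k where k: "\<not> p dvd \<xi> k" by blast
  have e1: "P ^ CARD('n) = P ^ 2 * P ^ (CARD('n) - 2)"
    using d by (metis le_add_diff_inverse power_add)
  have e2: "P ^ CARD('n) = P * P ^ (CARD('n) - 1)"
    using d by (simp flip: power_Suc)
  have "P\<^sup>2 * (2 * card W) \<le> P ^ 2 * P ^ (CARD('n) - 2)"
    using Q(2) unfolding cardW P_def by (intro mult_left_mono) auto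
  moreover have "2 * P ^ (CARD('n) - 1) < P * P ^ (CARD('n) - 1)"
    using P3 by (intro mult_strict_right_mono) auto
  ultimately have "nat p ^ (CARD('n) - 1) + (nat p)^2 * card W < nat p ^ CARD('n)"
    using e1 e2 unfolding P_def by linarith
  then obtain v where v: "\<And>i. v i \<in> {0..<p}" "\<not> p dvd idot v \<xi>"
    "\<And>u a b. u \<in> W \<Longrightarrow> \<exists>i. \<not> p dvd a * \<xi> i + b * v i - u i"
    using exists_transversal_vector[OF p(1) k finW xi(3)] by blast
  have "p dvd a \<and> p dvd b \<and> r = r'"
    if r: "\<And>i. r i \<in> {0..<int Q}" and r': "\<And>i. r' i \<in> {0..<int Q}"
      and dv: "\<And>i. p dvd a * \<xi> i + b * v i + r i - r' i" for a b r r'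
  proof -
    have rr: "r = r'"
    proof (rule ccontr)
      assume "r \<noteq> r'"
      then have "(\<lambda>i. r' i - r i) \<noteq> (\<lambda>_. 0)"
        using \<open>r \<noteq> r'\<close> by (metis eq_iff_diff_eq_0 ext)
      moreover have "r' i - r i \<in> {- (int Q - 1)..int Q - 1}" for i
        using r[of i] r'[of i] by auto
      ultimately have "(\<lambda>i. r' i - r i) \<in> W"
        by (simp add: W_def PiE_iff)
      then obtain i where "\<not> p dvd a * \<xi> i + b * v i - (r' i - r i)"
        using v(3) by blast
      then show False
        using dv[of i] by (simp add: algebra_simps)
    qed
    then have dv0: "\<And>i. p dvd a * \<xi> i + b * v i"
      using dv by simp
    have "p dvd a * idot \<xi> \<xi> + b * idot v \<xi>"
      unfolding idot_lincomb[symmetric] by (rule dvd_idot) (rule dv0)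
    moreover have "p dvd idot \<xi> \<xi>"
      using xi(1) by (meson dvd_trans dvd_power pos2)
    ultimately have "p dvd b * idot v \<xi>"
      by (simp add: dvd_add_right_iff)
    then have b: "p dvd b"
      using p(1) v(2) prime_dvd_mult_iff by blast
    then have "p dvd a * \<xi> k"
      using dv0[of k] by (simp add: dvd_add_left_iff)
    then have "p dvd a"
      using p(1) k prime_dvd_mult_iff by blast
    then show ?thesis
      using rr b by simp
  qed
  then show ?thesis
    using that xi(1) k v(1,2) by blast
qed

section \<open>The isotropic lattice\<close>

text \<open>
  If \<open>p\<^sup>2 dvd idot \<xi> \<xi>\<close>, then \<open>null_lattice p \<xi>\<close> is a lattice that is totally isotropic modulo \<open>p\<^sup>2\<close>. It consists
  of the multiples of \<open>\<xi>\<close> corrected by \<open>p\<close> times the vectors orthogonal to \<open>\<xi>\<close> modulo \<open>p\<close>.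
\<close>

definition null_lattice :: "int \<Rightarrow> ('n::finite \<Rightarrow> int) \<Rightarrow> ('n \<Rightarrow> int) set" where
  "null_lattice p \<xi> = {\<lambda>i. a * \<xi> i + p * w i | a w. p dvd idot w \<xi>}"

lemma null_lattice_isotropic:
  assumes "p^2 dvd idot \<xi> \<xi>" "x \<in> null_lattice p \<xi>" "y \<in> null_lattice p \<xi>"
  shows "p^2 dvd idot x y"
proof -
  obtain a w b z where x: "x = (\<lambda>i. a * \<xi> i + p * w i)" "p dvd idot w \<xi>"
    and y: "y = (\<lambda>i. b * \<xi> i + p * z i)" "p dvd idot z \<xi>"
    using assms(2,3) by (auto simp: null_lattice_def)
  have "idot x y = a * b * idot \<xi> \<xi> + a * (p * idot z \<xi>) + b * (p * idot w \<xi>) + p^2 * idot w z"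
    unfolding x y idot_lincomb idot_lincomb_right
    by (simp add: idot_commute[of \<xi> z] power2_eq_square algebra_simps)
  moreover have "p^2 dvd p * idot z \<xi>" "p^2 dvd p * idot w \<xi>"
    using x(2) y(2) by (simp_all add: power2_eq_square)
  ultimately show ?thesis
    using assms(1) by simp
qed

text \<open>
  The lattice has index at most \<open>p^d\<close>. The map \<open>f\<close> below, with at most \<open>p^d\<close> values, has fibres whose
  differences lie in the lattice: \<open>n\<close> is reduced by a multiple of \<open>\<xi>\<close> to a vector \<open>y n\<close> whose \<open>k\<close>-th entry is
  divisible by \<open>p\<close>, and \<open>f n\<close> records the other residues of \<open>y n\<close> together with the class of the
  quotient paired with \<open>\<xi>\<close>. The pigeonhole principle then produces short lattice vectors as differences.
\<close>

lemma exists_short_null_vectors: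
  fixes p :: int and N :: nat and \<xi> :: "'n::finite \<Rightarrow> int"
  assumes p: "prime p" and k: "\<not> p dvd \<xi> k"
  obtains S where "finite S" "S \<subseteq> null_lattice p \<xi>" "\<And>x i. x \<in> S \<Longrightarrow> \<bar>x i\<bar> \<le> int N"
    "(N + 1) ^ CARD('n) \<le> card S * nat p ^ CARD('n)"
proof -
  have pp: "p > 0" using p by (simp add: prime_gt_0_int)
  have "coprime (\<xi> k) p"
    using p k by (simp add: prime_imp_coprime coprime_commute)
  then obtain \<eta> where "[\<xi> k * \<eta> = 1] (mod p)"
    using cong_solve_coprime_int by blast
  then have eta: "p dvd 1 - \<xi> k * \<eta>"
    by (simp add: cong_iff_dvd_diff dvd_diff_commute)
  define y where "y = (\<lambda>(n::'n \<Rightarrow> int) i. n i - \<eta> * n k * \<xi> i)"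
  have yk: "p dvd y n k" for n
  proof -
    have "y n k = n k * (1 - \<xi> k * \<eta>)"
      by (simp add: y_def algebra_simps)
    then show ?thesis using eta by simp
  qed
  define f where "f = (\<lambda>n i. if i = k then idot (\<lambda>i. y n i div p) \<xi> mod p else y n i mod p)"
  define A where "A = (UNIV :: 'n set) \<rightarrow>\<^sub>E {0..int N}"
  define B where "B = (UNIV :: 'n set) \<rightarrow>\<^sub>E {0..<p}"
  have "f \<in> A \<rightarrow> B"
    using pp by (auto simp: f_def B_def)
  moreover have "finite A" "finite B"
    by (auto simp: A_def B_def intro!: finite_PiE)
  moreover have "B \<noteq> {}"
    using pp by (auto simp: B_def PiE_eq_empty_iff)
  ultimately obtain c where c: "c \<in> B" "card (f -` {c} \<inter> A) * card B \<ge> card A"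
    using pigeonhole_card by blast
  define S0 where "S0 = f -` {c} \<inter> A"
  have cA: "card A = (N + 1) ^ CARD('n)" and cB: "card B = nat p ^ CARD('n)"
    by (simp_all add: A_def B_def card_funcsetE nat_add_distrib)
  have "S0 \<noteq> {}"
    using c(2) cA by (auto simp: S0_def)
  then obtain n0 where n0: "n0 \<in> S0" by blast
  define S where "S = (\<lambda>n i. n i - n0 i) ` S0"
  have inj: "inj_on (\<lambda>n i. n i - n0 i) S0"
    by (auto simp: inj_on_def fun_eq_iff)
  have "S \<subseteq> null_lattice p \<xi>"
  proof
    fix x assume "x \<in> S"
    then obtain n where n: "n \<in> S0" and x: "x = (\<lambda>i. n i - n0 i)"
      by (auto simp: S_def)
    have ff: "f n i = f n0 i" for i
      using n n0 by (auto simp: S0_def)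
    have ym: "y n i mod p = y n0 i mod p" for i
      using ff[of i] yk[of n] yk[of n0] by (cases "i = k") (auto simp: f_def)
    define w where "w = (\<lambda>i. 1 * (y n i div p) + (-1) * (y n0 i div p))"
    have "idot w \<xi> = idot (\<lambda>i. y n i div p) \<xi> - idot (\<lambda>i. y n0 i div p) \<xi>"
      unfolding w_def idot_lincomb by simp
    then have "p dvd idot w \<xi>"
      using ff[of k] by (simp add: f_def mod_eq_dvd_iff)
    moreover have "x i = (\<eta> * (n k - n0 k)) * \<xi> i + p * w i" for i
    proof -
      have "p * w i = y n i - y n0 i"
        using ym[of i] mult_div_mod_eq[of p "y n i"] mult_div_mod_eq[of p "y n0 i"]
        unfolding w_def by (simp only: right_diff_distrib mult_1 mult_minus1 add_uminus_conv_diff)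
      then show ?thesis
        by (simp add: x y_def algebra_simps)
    qed
    ultimately show "x \<in> null_lattice p \<xi>"
      unfolding null_lattice_def by blast
  qed
  moreover have "\<bar>x i\<bar> \<le> int N" if xS: "x \<in> S" for x i
  proof -
    obtain n where n: "n \<in> S0" and x: "x = (\<lambda>i. n i - n0 i)"
      using xS by (auto simp: S_def)
    have "n i \<in> {0..int N}" "n0 i \<in> {0..int N}"
      using n n0 by (auto simp: S0_def A_def PiE_iff)
    then show ?thesis unfolding x by (simp add: abs_le_iff)
  qed
  moreover have "finite S"
    using \<open>finite A\<close> by (auto simp: S_def S0_def)
  moreover have "(N + 1) ^ CARD('n) \<le> card S * nat p ^ CARD('n)"
    using c(2) by (simp add: S_def card_image[OF inj] cA cB flip: S0_def)
  ultimately show ?thesis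
    using that by blast
qed

text \<open>
  At the time with index \<open>j\<close> the phases of all frequencies \<open>v + x\<close>, \<open>x\<close> in the lattice, agree at the point with index \<open>u\<close>.
  Since \<open>2jv\<close> must agree with \<open>u\<close> up to a lattice vector, \<open>j\<close> is found from \<open>2j = b\<close> modulo \<open>p\<close>, refined
  modulo \<open>p\<^sup>2\<close> with the help of the invertible number \<open>idot v \<xi>\<close>.
\<close>

lemma exists_focusing_time:
  fixes p :: int and \<xi> v u :: "'n::finite \<Rightarrow> int"
  assumes p: "prime p" "p > 2" and xi: "p^2 dvd idot \<xi> \<xi>" and v: "\<not> p dvd idot v \<xi>"
    and u: "\<And>i. p dvd u i - (a * \<xi> i + b * v i)"
  obtains j where "1 \<le> j" "j \<le> p^2"
    "\<And>x. x \<in> null_lattice p \<xi> \<Longrightarrow> p^2 dvd idot x u - j * (idot x x + 2 * idot x v)"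
proof -
  have oddp: "odd p"
    using p by (metis prime_odd_int)
  obtain w where w: "\<And>i. u i - (a * \<xi> i + b * v i) = p * w i"
    using u unfolding dvd_def by metis
  have "coprime (idot v \<xi>) p"
    using p v by (simp add: prime_imp_coprime coprime_commute)
  then obtain e0 where "[idot v \<xi> * e0 = 1] (mod p)"
    using cong_solve_coprime_int by blast
  then have e0: "p dvd idot v \<xi> * e0 - 1"
    by (simp add: cong_iff_dvd_diff)
  define e1 where "e1 = - idot w \<xi> * e0"
  have e1: "p dvd idot w \<xi> + e1 * idot v \<xi>"
  proof -
    have "idot w \<xi> + e1 * idot v \<xi> = - idot w \<xi> * (idot v \<xi> * e0 - 1)"
      by (simp add: e1_def algebra_simps)
    then show ?thesis using e0 by simp
  qed
  \<comment> \<open>Replacing \<open>e1\<close> by \<open>e1 + p\<close> changes the parity, as \<open>p\<close> is odd, so \<open>b - p * e\<close> can be halved.\<close>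
  define e where "e = (if even (b - p * e1) then e1 else e1 + p)"
  have even: "even (b - p * e)"
    using oddp by (auto simp: e_def)
  have e: "p dvd idot w \<xi> + e * idot v \<xi>"
  proof -
    have "idot w \<xi> + (e1 + p) * idot v \<xi> = (idot w \<xi> + e1 * idot v \<xi>) + p * idot v \<xi>"
      by (simp add: algebra_simps)
    then show ?thesis
      using e1 by (metis dvd_add dvd_mult2 dvd_refl e_def)
  qed
  obtain j0 where j0: "b - p * e = 2 * j0"
    using even by (rule evenE)
  \<comment> \<open>Only \<open>j0\<close> modulo \<open>p\<^sup>2\<close> matters; the residue in \<open>1..p\<^sup>2\<close> makes the time positive.\<close>
  define j where "j = (j0 - 1) mod p^2 + 1"
  have pp: "p^2 > 0" using p by simp
  have main: "p^2 dvd idot x u - j * (idot x x + 2 * idot x v)" if x: "x \<in> null_lattice p \<xi>" for x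
  proof -
    \<comment> \<open>\<open>\<mu>\<close> is the lattice vector \<open>u - 2 j0 v\<close>.\<close>
    define z where "z = (\<lambda>i. 1 * w i + e * v i)"
    define \<mu> where "\<mu> = (\<lambda>i. a * \<xi> i + p * z i)"
    have "p dvd idot z \<xi>"
      unfolding z_def idot_lincomb using e by simp
    then have mu: "\<mu> \<in> null_lattice p \<xi>"
      unfolding \<mu>_def null_lattice_def by blast
    have "u i = 1 * \<mu> i + (2 * j0) * v i" for i
    proof -
      have "u i = a * \<xi> i + (2 * j0 + p * e) * v i + p * w i"
        using w[of i] j0 by (simp add: algebra_simps)
      then show ?thesis
        by (simp add: \<mu>_def z_def algebra_simps)
    qed
    then have "u = (\<lambda>i. 1 * \<mu> i + (2 * j0) * v i)"
      by blast
    then have "idot x u = idot x \<mu> + 2 * j0 * idot x v"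
      by (simp add: idot_lincomb_right[of x 1, simplified])
    then have "idot x u - j * (idot x x + 2 * idot x v)
      = idot x \<mu> - j * idot x x + 2 * idot x v * (j0 - j)"
      by (simp add: algebra_simps)
    moreover have "p^2 dvd j0 - j"
    proof -
      have "j0 - j = (j0 - 1) - (j0 - 1) mod p^2"
        by (simp add: j_def)
      then show ?thesis
        by (metis dvd_minus_mod)
    qed
    ultimately show ?thesis
      using null_lattice_isotropic[OF xi x mu] null_lattice_isotropic[OF xi x x] by simp
  qed
  have "1 \<le> j" "j \<le> p^2"
    using pos_mod_bound[OF pp, of "j0 - 1"] pos_mod_sign[OF pp, of "j0 - 1"] by (auto simp: j_def)
  then show ?thesis
    using that main by blast
qed

text \<open>
  A prime factor \<open>p\<close> of \<open>(m!)\<^sup>2 + 1\<close> exceeds \<open>m\<close>, and the root \<open>m!\<close> of \<open>-1\<close> modulo \<open>p\<close> is lifted to one modulo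
  \<open>p\<^sup>2\<close> by a Newton step.
\<close>

lemma exists_prime_sqrt_minus_one:
  obtains p \<iota> :: int where "prime p" "p > max 2 n" "p^2 dvd \<iota>^2 + 1"
proof -
  define m where "m = nat (max 2 n)"
  define f :: int where "f = fact m"
  have m2: "m \<ge> 2" by (auto simp: m_def)
  have "f^2 + 1 > 1" by (simp add: f_def)
  then obtain p where p: "prime p" "p dvd f^2 + 1"
    using prime_factor_int[of "f^2+1"] by force
  have ndf: "\<not> p dvd f"
  proof
    assume "p dvd f"
    then have "p dvd f^2" by (simp add: power2_eq_square)
    then have "p dvd 1" using p(2) dvd_add_right_iff by blast
    then show False using p(1) by (simp add: not_prime_unit)
  qed
  have "p > int m"
  proof (rule ccontr)
    assume "\<not> p > int m"
    then have "nat p \<le> m" "1 \<le> nat p" using p(1) prime_gt_0_int[of p] by auto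
    then have "nat p dvd fact m" by (rule dvd_fact[rotated])
    then have "p dvd f"
      using p(1) prime_gt_0_int[of p] by (metis f_def int_dvd_int_iff int_nat_eq of_nat_fact order_less_imp_le)
    then show False using ndf by simp
  qed
  then have pm: "p > max 2 n" unfolding m_def by linarith
  then have "\<not> p dvd 2"
    using zdvd_imp_le by fastforce
  then have "\<not> p dvd 2 * f"
    using p(1) ndf prime_dvd_mult_iff by blast
  then have "coprime (2 * f) p"
    using p(1) prime_imp_coprime coprime_commute by blast
  then obtain g where "[(2 * f) * g = 1] (mod p)"
    using cong_solve_coprime_int by blast
  then have g: "p dvd 2 * f * g - 1"
    by (simp add: cong_iff_dvd_diff)
  obtain e where e: "f^2 + 1 = p * e"
    using p(2) by (rule dvdE)
  define \<iota> where "\<iota> = f - p * (e * g)"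
  have "\<iota>^2 + 1 = (f^2 + 1) - p * (e * (2 * f * g)) + p^2 * (e * g)^2"
    by (simp add: \<iota>_def power2_eq_square algebra_simps)
  also have "\<dots> = p^2 * (e * g)^2 - p * (e * (2 * f * g - 1))"
    unfolding e by (simp add: algebra_simps)
  also have "p^2 dvd \<dots>"
    using g by (simp add: power2_eq_square)
  finally show ?thesis
    using that p(1) pm by blast
qed

section \<open>Fourier analysis of trigonometric sums on the torus\<close>

lemma measure_lborel_box_vec:
  fixes a b :: "real ^ 'n::finite"
  assumes "\<And>i. a $ i \<le> b $ i"
  shows "measure lborel (box a b) = (\<Prod>i\<in>UNIV. b $ i - a $ i)"
    and "measure lborel (cbox a b) = (\<Prod>i\<in>UNIV. b $ i - a $ i)"
proof -
  have le: "\<And>c. c \<in> Basis \<Longrightarrow> a \<bullet> c \<le> b \<bullet> c"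
    using assms by (auto simp: Basis_vec_def inner_axis)
  have "cbox a b \<noteq> {}"
    using assms by (simp add: interval_ne_empty_cart)
  then show "measure lborel (cbox a b) = (\<Prod>i\<in>UNIV. b $ i - a $ i)"
    by (rule content_cbox_cart)
  moreover have "measure lborel (box a b) = measure lborel (cbox a b)"
    using le by (simp only: measure_lborel_box measure_lborel_cbox)
  ultimately show "measure lborel (box a b) = (\<Prod>i\<in>UNIV. b $ i - a $ i)"
    by simp
qed

lemma torus_box_sets: "(torus_box :: (real ^ 'n::finite) set) \<in> sets borel"
proof -
  have "torus_box = (\<Inter>i. {x :: real ^ 'n. 0 \<le> x $ i} \<inter> {x. x $ i < 2 * pi})"
    by (auto simp: torus_box_def)
  also have "\<dots> \<in> sets borel"
    by (intro sets.countable_INT'' sets.Int borel_closed borel_open closed_Collect_le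
        open_Collect_less continuous_intros) auto
  finally show ?thesis .
qed

lemma emeasure_torus_box:
  "emeasure lborel (torus_box :: (real ^ 'n::finite) set) = ennreal ((2 * pi) ^ CARD('n))"
proof -
  define b :: "real ^ 'n" where "b = (\<chi> i. 2 * pi)"
  have 1: "box 0 b \<subseteq> torus_box"
    by (auto simp: torus_box_def mem_box_cart b_def less_imp_le)
  have 2: "torus_box \<subseteq> cbox 0 b"
    by (auto simp: torus_box_def mem_box_cart b_def less_imp_le)
  have m: "measure lborel (box 0 b) = (2 * pi) ^ CARD('n)" "measure lborel (cbox 0 b) = (2 * pi) ^ CARD('n)"
    by (subst measure_lborel_box_vec; simp add: b_def)+
  have "emeasure lborel (box 0 b) \<le> emeasure lborel (torus_box :: (real ^ 'n) set)"
    using 1 torus_box_sets by (intro emeasure_mono) auto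
  moreover have "emeasure lborel (torus_box :: (real ^ 'n) set) \<le> emeasure lborel (cbox 0 b)"
    using 2 by (intro emeasure_mono) auto
  moreover have "emeasure lborel (box 0 b) = ennreal (measure lborel (box 0 b))"
    by (intro emeasure_eq_ennreal_measure) (metis emeasure_bounded_finite bounded_box less_top infinity_ennreal_def)
  moreover have "emeasure lborel (cbox 0 b) = ennreal (measure lborel (cbox 0 b))"
    by (intro emeasure_eq_ennreal_measure) (metis emeasure_bounded_finite bounded_cbox less_top infinity_ennreal_def)
  ultimately show ?thesis
    using m by (metis order_antisym)
qed

lemma measure_torus_box:
  "measure lborel (torus_box :: (real ^ 'n::finite) set) = (2 * pi) ^ CARD('n)"
  by (simp add: measure_def emeasure_torus_box)

lemma measure_torus_measure:
  fixes A :: "(real ^ 'n::finite) set"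
  assumes "A \<in> sets borel" "A \<subseteq> torus_box"
  shows "measure torus_measure A = measure lborel A / (2 * pi) ^ CARD('n)"
proof -
  have "measure torus_measure A = measure lborel (torus_box \<inter> A) / measure lborel (torus_box :: (real ^ 'n) set)"
    unfolding torus_measure_def using assms torus_box_sets
    by (intro measure_uniform_measure) (auto simp: emeasure_torus_box)
  then show ?thesis
    using assms(2) by (simp add: measure_torus_box Int_absorb1)
qed

lemma integral_torus_measure:
  fixes f :: "real ^ 'n::finite \<Rightarrow> 'b::{banach, second_countable_topology}"
  assumes [measurable]: "f \<in> borel_measurable borel"
  shows "(LINT x|torus_measure. f x) =
    (LINT x|lborel. indicator torus_box x *\<^sub>R f x) /\<^sub>R (2 * pi) ^ CARD('n)"
proof -
  have [measurable]: "(torus_box :: (real ^ 'n) set) \<in> sets borel"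
    by (rule torus_box_sets)
  have "torus_measure = density lborel (\<lambda>x :: real ^ 'n. ennreal (indicator torus_box x / (2 * pi) ^ CARD('n)))"
    unfolding torus_measure_def uniform_measure_def emeasure_torus_box
    by (intro arg_cong[of _ _ "density lborel"] ext)
      (auto simp: indicator_def divide_ennreal[symmetric] simp flip: ennreal_1)
  then have "(LINT x|torus_measure. f x) =
      (LINT x|density lborel (\<lambda>x :: real ^ 'n. ennreal (indicator torus_box x / (2 * pi) ^ CARD('n))). f x)"
    by (simp only:)
  also have "\<dots> = (LINT x|lborel. (indicator torus_box x / (2 * pi) ^ CARD('n)) *\<^sub>R f x)"
    by (rule integral_density) auto
  also have "\<dots> = (LINT x|lborel. (1 / (2 * pi) ^ CARD('n)) *\<^sub>R (indicator torus_box x *\<^sub>R f x))"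
    by simp
  finally show ?thesis
    by (simp only: integral_scaleR_right) (simp add: inverse_eq_divide)
qed

lemma emeasure_torus_measure_space:
  "emeasure (torus_measure :: (real ^ 'n::finite) measure) (space torus_measure) = 1"
proof -
  have "emeasure (torus_measure :: (real ^ 'n) measure) (space torus_measure)
      = emeasure lborel (torus_box \<inter> UNIV :: (real ^ 'n) set) / emeasure lborel (torus_box :: (real ^ 'n) set)"
    unfolding torus_measure_def using torus_box_sets by (subst emeasure_uniform_measure) auto
  also have "\<dots> = 1"
    by (simp add: emeasure_torus_box divide_ennreal)
  finally show ?thesis .
qed

lemma integrable_torus_measure:
  fixes f :: "real ^ 'n::finite \<Rightarrow> 'b::{banach, second_countable_topology}"
  assumes "f \<in> borel_measurable borel" and "\<And>x. norm (f x) \<le> K"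
  shows "integrable torus_measure f"
proof -
  have fin: "finite_measure (torus_measure :: (real ^ 'n) measure)"
    by (rule finite_measureI) (simp add: emeasure_torus_measure_space)
  have "f \<in> borel_measurable torus_measure"
    using assms(1) by (simp add: torus_measure_def measurable_cong_sets[OF sets_uniform_measure refl])
  then show ?thesis
    using assms(2) by (intro finite_measure.integrable_const_bound[OF fin, of _ K]) auto
qed

lemma integral_lborel_translate:
  fixes f :: "'a::euclidean_space \<Rightarrow> 'b::{banach, second_countable_topology}"
  assumes "f \<in> borel_measurable borel"
  shows "(LINT x|lborel. f (c + x)) = (LINT x|lborel. f x)"
proof -
  have "(LINT x|lborel. f x) = (LINT x|distr lborel borel ((+) c). f x)"
    by (simp add: lborel_distr_plus)
  also have "\<dots> = (LINT x|lborel. f (c + x))"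
    using assms by (subst integral_distr) auto
  finally show ?thesis by simp
qed

lemma borel_measurable_cis_inner [measurable]:
  "(\<lambda>x :: real ^ 'n::finite. cis (k \<bullet> x)) \<in> borel_measurable borel"
  unfolding cis_conv_exp by (intro borel_measurable_continuous_onI continuous_intros)

text \<open>
  Translating by \<open>s = pi / |n\<^sub>i|\<close> in a coordinate with \<open>n\<^sub>i \<noteq> 0\<close> changes the sign of the character. The box is
  cut in two ways, as \<open>A \<union> C\<close> and as \<open>D \<union> E\<close>, so that by periodicity the translation carries \<open>D\<close> to \<open>C\<close> and,
  after subtracting a period, \<open>E\<close> to \<open>A\<close>. So the integral equals its own negative.
\<close>

lemma integral_cis_torus_box_eq_0:
  fixes n :: "int ^ 'n::finite"
  assumes "n \<noteq> 0"
  shows "(LINT x|lborel. indicator torus_box x *\<^sub>R cis (freq n \<bullet> x)) = 0"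
proof -
  obtain i where i: "n $ i \<noteq> 0"
    using assms by (auto simp: vec_eq_iff)
  define N where "N = \<bar>of_int (n $ i) :: real\<bar>"
  define s where "s = pi / N"
  define e :: "real ^ 'n" where "e = axis i 1"
  define f where "f = (\<lambda>x. cis (freq n \<bullet> x))"
  have n1: "1 \<le> N"
    using i unfolding N_def by linarith
  have s: "0 < s" "s \<le> pi"
    using n1 frac_le[of pi pi 1 N] by (simp_all add: s_def)
  have fe: "freq n \<bullet> (c *\<^sub>R e) = c * of_int (n $ i)" for c
    by (simp add: e_def freq_def inner_axis)
  have f_neg: "f (s *\<^sub>R e + x) = - f x" for x
  proof -
    have "s * of_int (n $ i) = pi \<or> s * of_int (n $ i) = - pi"
      using n1 unfolding s_def N_def by (cases "n $ i \<ge> 0") (auto simp: abs_if)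
    then have "cis (s * of_int (n $ i)) = -1"
      by (auto simp: complex_eq_iff)
    then show ?thesis
      unfolding f_def inner_add_right fe cis_mult[symmetric] by simp
  qed
  have f_per: "f ((s - 2 * pi) *\<^sub>R e + x) = - f x" for x
  proof -
    have "cis (- (2 * pi * of_int (n $ i))) = 1"
      using cis_multiple_2pi[of "of_int (- n $ i)"] by simp
    moreover have "freq n \<bullet> ((s - 2 * pi) *\<^sub>R e + x) = freq n \<bullet> (s *\<^sub>R e + x) + - (2 * pi * of_int (n $ i))"
      unfolding inner_add_right fe by (simp add: algebra_simps)
    ultimately have "f ((s - 2 * pi) *\<^sub>R e + x) = f (s *\<^sub>R e + x)"
      unfolding f_def by (simp only: cis_mult[symmetric] mult_1_right)
    then show ?thesis by (simp add: f_neg)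
  qed
  have nth: "(c *\<^sub>R e + x) $ j = (if j = i then c + x $ j else x $ j)" for c x j
    by (simp add: e_def axis_def)
  have box_iff: "z \<in> torus_box \<longleftrightarrow> (0 \<le> z $ i \<and> z $ i < 2 * pi) \<and> (\<forall>j. j \<noteq> i \<longrightarrow> 0 \<le> z $ j \<and> z $ j < 2 * pi)"
    for z :: "real ^ 'n"
    unfolding torus_box_def mem_Collect_eq by metis
  define A where "A = {x \<in> torus_box. x $ i < s}"
  define C where "C = {x \<in> torus_box. s \<le> x $ i}"
  define D where "D = {x \<in> torus_box. x $ i < 2 * pi - s}"
  define E where "E = {x \<in> torus_box. 2 * pi - s \<le> x $ i}"
  have half: "{x :: real ^ 'n. x $ i < c} \<in> sets borel" "{x :: real ^ 'n. c \<le> x $ i} \<in> sets borel" for c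
    by (intro borel_closed borel_open closed_Collect_le open_Collect_less continuous_intros)+
  have [measurable]: "A \<in> sets borel" "C \<in> sets borel" "D \<in> sets borel" "E \<in> sets borel"
    unfolding A_def C_def D_def E_def Collect_conj_eq Collect_mem_eq
    by (intro sets.Int torus_box_sets half)+
  have [measurable]: "f \<in> borel_measurable borel"
    unfolding f_def by measurable
  have int: "integrable lborel (\<lambda>x. indicator S x *\<^sub>R f x)" if "S \<in> sets borel" "S \<subseteq> torus_box" for S
  proof (rule integrableI_bounded_set_indicator[of _ _ _ 1])
    have "emeasure lborel S \<le> emeasure lborel (torus_box :: (real ^ 'n) set)"
      using that torus_box_sets by (intro emeasure_mono) auto
    then show "emeasure lborel S < \<infinity>"
      by (simp add: emeasure_torus_box order_le_less_trans)
  qed (use that in \<open>auto simp: f_def\<close>)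
  have IC: "(LINT x|lborel. indicator C x *\<^sub>R f x) = - (LINT x|lborel. indicator D x *\<^sub>R f x)"
  proof -
    have "(LINT x|lborel. indicator C x *\<^sub>R f x)
        = (LINT x|lborel. indicator C (s *\<^sub>R e + x) *\<^sub>R f (s *\<^sub>R e + x))"
      by (rule integral_lborel_translate[symmetric]) measurable
    also have "\<dots> = (LINT x|lborel. - (indicator D x *\<^sub>R f x))"
    proof (rule Bochner_Integration.integral_cong)
      fix x
      have "s *\<^sub>R e + x \<in> C \<longleftrightarrow> x \<in> D"
        using s unfolding C_def D_def mem_Collect_eq box_iff nth by auto
      then show "indicator C (s *\<^sub>R e + x) *\<^sub>R f (s *\<^sub>R e + x) = - (indicator D x *\<^sub>R f x)"
        by (simp add: f_neg indicator_def)
    qed simp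
    finally show ?thesis by simp
  qed
  have IA: "(LINT x|lborel. indicator A x *\<^sub>R f x) = - (LINT x|lborel. indicator E x *\<^sub>R f x)"
  proof -
    have "(LINT x|lborel. indicator A x *\<^sub>R f x)
        = (LINT x|lborel. indicator A ((s - 2 * pi) *\<^sub>R e + x) *\<^sub>R f ((s - 2 * pi) *\<^sub>R e + x))"
      by (rule integral_lborel_translate[symmetric]) measurable
    also have "\<dots> = (LINT x|lborel. - (indicator E x *\<^sub>R f x))"
    proof (rule Bochner_Integration.integral_cong)
      fix x
      have "(s - 2 * pi) *\<^sub>R e + x \<in> A \<longleftrightarrow> x \<in> E"
        using s unfolding A_def E_def mem_Collect_eq box_iff nth by auto
      then show "indicator A ((s - 2 * pi) *\<^sub>R e + x) *\<^sub>R f ((s - 2 * pi) *\<^sub>R e + x) = - (indicator E x *\<^sub>R f x)"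
        by (simp add: f_per indicator_def)
    qed simp
    finally show ?thesis by simp
  qed
  have split1: "indicator torus_box x *\<^sub>R f x = indicator A x *\<^sub>R f x + indicator C x *\<^sub>R f x" for x
    by (auto simp: A_def C_def indicator_def)
  have split2: "indicator torus_box x *\<^sub>R f x = indicator D x *\<^sub>R f x + indicator E x *\<^sub>R f x" for x
    by (auto simp: D_def E_def indicator_def)
  have sub: "A \<subseteq> torus_box" "C \<subseteq> torus_box" "D \<subseteq> torus_box" "E \<subseteq> torus_box"
    by (auto simp: A_def C_def D_def E_def)
  define I where "I = (LINT x|lborel. indicator torus_box x *\<^sub>R f x)"
  have "I = (LINT x|lborel. indicator A x *\<^sub>R f x) + (LINT x|lborel. indicator C x *\<^sub>R f x)"
    unfolding I_def split1 by (intro Bochner_Integration.integral_add int sub) measurable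
  moreover have "I = (LINT x|lborel. indicator D x *\<^sub>R f x) + (LINT x|lborel. indicator E x *\<^sub>R f x)"
    unfolding I_def split2 by (intro Bochner_Integration.integral_add int sub) measurable
  ultimately have "I = - I"
    using IA IC by simp
  then have "I = 0"
    by (simp add: complex_eq_iff)
  then show ?thesis
    by (simp add: I_def f_def)
qed

lemma integral_cis_torus:
  fixes n :: "int ^ 'n::finite"
  shows "(LINT x|torus_measure. cis (freq n \<bullet> x)) = (if n = 0 then 1 else 0)"
proof (cases "n = 0")
  case True
  have "freq n = 0"
    using True by (simp add: freq_def vec_eq_iff)
  then show ?thesis
    using True by (simp add: measure_def emeasure_torus_measure_space)
next
  case False
  then show ?thesis
    by (simp add: integral_torus_measure integral_cis_torus_box_eq_0)
qed

lemma freq_diff: "freq (m - n) = freq m - freq n"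
  by (simp add: freq_def vec_eq_iff)

lemma integral_cis_torus_orthonormal:
  fixes m n :: "int ^ 'n::finite"
  shows "(LINT x|torus_measure. cis (freq m \<bullet> x) * cis (- (freq n \<bullet> x))) = (if m = n then 1 else 0)"
  using integral_cis_torus[of "m - n"] by (simp add: cis_mult freq_diff inner_diff_left)

lemma integrable_cis_mult_torus:
  "integrable torus_measure (\<lambda>x :: real ^ 'n::finite. c * (cis (k \<bullet> x) * cis (- (l \<bullet> x))))"
proof (rule integrable_torus_measure[of _ "norm c"])
  show "(\<lambda>x. c * (cis (k \<bullet> x) * cis (- (l \<bullet> x)))) \<in> borel_measurable borel"
    unfolding cis_conv_exp by (intro borel_measurable_continuous_onI continuous_intros)
qed (simp add: norm_mult)

lemma fourier_coeff_trig_sum: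
  fixes S :: "(int ^ 'n::finite) set"
  assumes "finite S"
  shows "fourier_coeff (\<lambda>x. \<Sum>m\<in>S. a m * cis (freq m \<bullet> x)) n = (if n \<in> S then a n else 0)"
proof -
  have "fourier_coeff (\<lambda>x. \<Sum>m\<in>S. a m * cis (freq m \<bullet> x)) n
      = (LINT x|torus_measure. (\<Sum>m\<in>S. a m * (cis (freq m \<bullet> x) * cis (- (freq n \<bullet> x)))))"
    unfolding fourier_coeff_def sum_distrib_right by (simp only: mult.assoc)
  also have "\<dots> = (\<Sum>m\<in>S. a m * (LINT x|torus_measure. cis (freq m \<bullet> x) * cis (- (freq n \<bullet> x))))"
    by (subst Bochner_Integration.integral_sum) (auto intro: integrable_cis_mult_torus)
  also have "\<dots> = (\<Sum>m\<in>S. a m * (if m = n then 1 else 0))"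
    by (simp only: integral_cis_torus_orthonormal)
  also have "\<dots> = (if n \<in> S then a n else 0)"
    using assms by (simp add: if_distrib cong: if_cong)
  finally show ?thesis .
qed

lemma torus_L2_norm_trig_sum:
  fixes S :: "(int ^ 'n::finite) set"
  assumes "finite S"
  shows "torus_L2_norm (\<lambda>x. \<Sum>m\<in>S. a m * cis (freq m \<bullet> x)) = sqrt (\<Sum>m\<in>S. (norm (a m))\<^sup>2)"
proof -
  let ?G = "\<lambda>x. \<Sum>m\<in>S. a m * cis (freq m \<bullet> x)"
  have "complex_of_real (LINT x|torus_measure. (norm (?G x))\<^sup>2) =
      (LINT x|torus_measure. complex_of_real ((norm (?G x))\<^sup>2))"
    by (rule integral_complex_of_real[symmetric])
  also have "\<dots> = (LINT x|torus_measure. (\<Sum>m\<in>S. \<Sum>n\<in>S. (a m * cnj (a n)) * (cis (freq m \<bullet> x) * cis (- (freq n \<bullet> x)))))"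
    by (intro Bochner_Integration.integral_cong)
      (simp_all only: complex_norm_square cnj_sum sum_product complex_cnj_mult cis_cnj mult_ac)
  also have "\<dots> = (\<Sum>m\<in>S. \<Sum>n\<in>S. (a m * cnj (a n)) * (if m = n then 1 else 0))"
    by (subst Bochner_Integration.integral_sum, auto intro!: Bochner_Integration.integrable_sum integrable_cis_mult_torus sum.cong)
      (subst Bochner_Integration.integral_sum, auto intro!: integrable_cis_mult_torus sum.cong simp: integral_cis_torus_orthonormal)
  also have "\<dots> = complex_of_real (\<Sum>m\<in>S. (norm (a m))\<^sup>2)"
    using assms by (simp add: if_distrib cong: if_cong flip: complex_norm_square)
  finally show ?thesis
    unfolding torus_L2_norm_def by (simp only: of_real_eq_iff)
qed

lemma schroedinger_trig_sum:
  fixes S :: "(int ^ 'n::finite) set"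
  assumes "finite S"
  shows "schroedinger t (\<lambda>x. \<Sum>m\<in>S. a m * cis (freq m \<bullet> x)) x =
    (\<Sum>n\<in>S. a n * cis (freq n \<bullet> x - t * (norm (freq n))\<^sup>2))"
proof -
  have "schroedinger t (\<lambda>x. \<Sum>m\<in>S. a m * cis (freq m \<bullet> x)) x =
      (\<Sum>\<^sub>\<infinity>n\<in>S. a n * cis (freq n \<bullet> x - t * (norm (freq n))\<^sup>2))"
    unfolding schroedinger_def fourier_coeff_trig_sum[OF assms]
    by (rule infsum_cong_neutral) auto
  then show ?thesis
    using assms by simp
qed

lemma norm_schroedinger_trig_sum_le:
  fixes S :: "(int ^ 'n::finite) set"
  assumes "finite S"
  shows "norm (schroedinger t (\<lambda>x. \<Sum>m\<in>S. a m * cis (freq m \<bullet> x)) x) \<le> (\<Sum>n\<in>S. norm (a n))"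
  unfolding schroedinger_trig_sum[OF assms] by (rule sum_norm_le) (simp add: norm_mult)

text \<open>
  The supremum of an uncountable family of continuous functions is lower semicontinuous. For the
  closed level set this yields a countable intersection of open sets.
\<close>

lemma SUP_level_set_borel:
  fixes f :: "'t \<Rightarrow> 'a::topological_space \<Rightarrow> real"
  assumes cont: "\<And>t. t \<in> I \<Longrightarrow> continuous_on UNIV (f t)"
    and bdd: "\<And>x. bdd_above ((\<lambda>t. f t x) ` I)" and "I \<noteq> {}"
  shows "{x. y \<le> (SUP t\<in>I. f t x)} \<in> sets borel"
proof -
  have "y \<le> (SUP t\<in>I. f t x) \<longleftrightarrow> (\<forall>k::nat. \<exists>t\<in>I. y - 1 / Suc k < f t x)" for x
  proof
    assume y: "y \<le> (SUP t\<in>I. f t x)"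
    show "\<forall>k::nat. \<exists>t\<in>I. y - 1 / Suc k < f t x"
    proof
      fix k :: nat
      have "0 < 1 / real (Suc k)" by simp
      with y have "y - 1 / Suc k < (SUP t\<in>I. f t x)" by linarith
      then show "\<exists>t\<in>I. y - 1 / Suc k < f t x"
        using less_cSUP_iff[OF \<open>I \<noteq> {}\<close> bdd] by blast
    qed
  next
    assume *: "\<forall>k::nat. \<exists>t\<in>I. y - 1 / Suc k < f t x"
    show "y \<le> (SUP t\<in>I. f t x)"
    proof (rule field_le_epsilon)
      fix e :: real assume "e > 0"
      then obtain k :: nat where k: "1 / Suc k < e"
        using nat_approx_posE by metis
      obtain t where t: "t \<in> I" "y - 1 / Suc k < f t x"
        using * by blast
      have "f t x \<le> (SUP t\<in>I. f t x)"
        by (rule cSUP_upper[OF t(1) bdd])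
      then show "y \<le> (SUP t\<in>I. f t x) + e"
        using k t(2) by linarith
    qed
  qed
  then have "{x. y \<le> (SUP t\<in>I. f t x)} = (\<Inter>k::nat. \<Union>t\<in>I. {x. y - 1 / Suc k < f t x})"
    by auto
  moreover have "open (\<Union>t\<in>I. {x. y - 1 / Suc k < f t x})" for k :: nat
    by (intro open_UN ballI open_Collect_less cont continuous_on_const)
  ultimately show ?thesis
    by (auto intro!: sets.countable_INT'' borel_open)
qed

section \<open>Unions of grid cells\<close>

text \<open>
  The torus is divided into cells of side \<open>2 * pi / (L * p)\<close>, indexed by integer vectors. Those cells
  whose index reduces modulo \<open>p\<close> to an element of \<open>W\<close> fill a proportion \<open>card W / p^d\<close>. It suffices to count
  their interiors.
\<close>

lemma measure_ge_grid_cells: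
  fixes X :: "(real ^ 'n::finite) set" and p L :: int and W :: "('n \<Rightarrow> int) set"
  assumes pos: "p > 0" "L > 0" and W: "finite W" "\<And>w i. w \<in> W \<Longrightarrow> w i \<in> {0..<p}"
    and X: "X \<in> sets borel" "X \<subseteq> torus_box"
    and cells: "\<And>x. x \<in> torus_box \<Longrightarrow> (\<lambda>i. \<lfloor>x $ i * of_int (L * p) / (2 * pi)\<rfloor> mod p) \<in> W \<Longrightarrow> x \<in> X"
  shows "real (card W) / of_int p ^ CARD('n) \<le> measure torus_measure X"
proof -
  define h :: real where "h = 2 * pi / of_int (L * p)"
  define Z where "Z = (UNIV :: 'n set) \<rightarrow>\<^sub>E {0..<L}"
  define lo :: "('n \<Rightarrow> int) \<times> ('n \<Rightarrow> int) \<Rightarrow> real ^ 'n"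
    where "lo = (\<lambda>(w, z). \<chi> i. h * of_int (w i + p * z i))"
  define cell where "cell = (\<lambda>k. box (lo k) (lo k + (\<chi> i. h)))"
  have h: "h > 0" using pos by (simp add: h_def)
  have hLp: "h * of_int (L * p) = 2 * pi" using pos by (simp add: h_def)
  have floor: "\<lfloor>x $ i * of_int (L * p) / (2 * pi)\<rfloor> = w i + p * z i"
    if "x \<in> cell (w, z)" for x w z i
  proof -
    have "h * of_int (w i + p * z i) < x $ i" "x $ i < h * of_int (w i + p * z i) + h"
      using that by (auto simp: cell_def lo_def mem_box_cart)
    then have "of_int (w i + p * z i) < x $ i / h" "x $ i / h < of_int (w i + p * z i) + 1"
      using h by (simp_all add: pos_less_divide_eq pos_divide_less_eq algebra_simps)
    moreover have "x $ i * of_int (L * p) / (2 * pi) = x $ i / h"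
      by (simp add: h_def)
    ultimately show ?thesis
      by (simp only: floor_unique less_imp_le)
  qed
  have sub: "cell (w, z) \<subseteq> X" if "w \<in> W" "z \<in> Z" for w z
  proof
    fix x assume x: "x \<in> cell (w, z)"
    have wz: "0 \<le> w i + p * z i" "w i + p * z i + 1 \<le> L * p" for i
    proof -
      have "0 \<le> w i" "w i < p" "0 \<le> z i" "z i \<le> L - 1"
        using W(2)[OF that(1), of i] that(2) by (auto simp: Z_def PiE_iff)
      moreover have "p * z i \<le> p * (L - 1)" "0 \<le> p * z i"
        using pos calculation by (simp_all add: mult_left_mono)
      ultimately show "0 \<le> w i + p * z i" "w i + p * z i + 1 \<le> L * p"
        by (simp_all add: algebra_simps)
    qed
    have "0 \<le> x $ i \<and> x $ i < 2 * pi" for i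
    proof -
      have a: "h * of_int (w i + p * z i) < x $ i" "x $ i < h * of_int (w i + p * z i + 1)"
        using x by (auto simp: cell_def lo_def mem_box_cart algebra_simps)
      have "0 \<le> h * of_int (w i + p * z i)"
        using h wz(1)[of i] by (intro mult_nonneg_nonneg) (auto simp del: of_int_add of_int_mult)
      moreover have "h * of_int (w i + p * z i + 1) \<le> h * of_int (L * p)"
        using h wz(2)[of i] by (intro mult_left_mono) (auto simp only: of_int_le_iff)
      ultimately show ?thesis
        using a hLp by linarith
    qed
    then have "x \<in> torus_box" by (simp add: torus_box_def)
    moreover have "(\<lambda>i. \<lfloor>x $ i * of_int (L * p) / (2 * pi)\<rfloor> mod p) = w"
      unfolding floor[OF x] using W(2)[OF that(1)] by auto
    ultimately show "x \<in> X"
      using cells that(1) by simp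
  qed
  have disj: "disjoint_family_on cell (W \<times> Z)"
    unfolding disjoint_family_on_def
  proof (intro ballI impI)
    fix k l assume k: "k \<in> W \<times> Z" and l: "l \<in> W \<times> Z" and "k \<noteq> l"
    show "cell k \<inter> cell l = {}"
    proof (rule ccontr)
      assume "cell k \<inter> cell l \<noteq> {}"
      then obtain x where x: "x \<in> cell k" "x \<in> cell l" by blast
      obtain w z w' z' where kl: "k = (w, z)" "l = (w', z')" by (metis surj_pair)
      have eq: "w i + p * z i = w' i + p * z' i" for i
        using floor[of x w z i] floor[of x w' z' i] x kl by simp
      have "w i = w' i" for i
      proof -
        have "(w i + p * z i) mod p = (w' i + p * z' i) mod p"
          by (simp only: eq)
        then show ?thesis
          using W(2)[of w i] W(2)[of w' i] k l kl by simp
      qed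
      moreover from this have "z i = z' i" for i
        using eq[of i] pos by simp
      ultimately show False
        using \<open>k \<noteq> l\<close> kl by auto
    qed
  qed
  have finZ: "finite Z" by (auto simp: Z_def intro!: finite_PiE)
  have meas: "measure lborel (cell k) = h ^ CARD('n)" for k
    unfolding cell_def by (subst measure_lborel_box_vec) (use h in auto)
  have "(\<Sum>k\<in>W \<times> Z. measure lborel (cell k)) = measure lborel (\<Union>k\<in>W \<times> Z. cell k)"
  proof (rule measure_finite_Union[symmetric])
    show "emeasure lborel (cell k) \<noteq> \<infinity>" for k
      unfolding cell_def by (metis emeasure_bounded_finite bounded_box less_irrefl infinity_ennreal_def)
  qed (use W finZ disj in \<open>auto simp: cell_def\<close>)
  also have "\<dots> \<le> measure lborel X"
  proof (rule measure_mono_fmeasurable)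
    show "(\<Union>k\<in>W \<times> Z. cell k) \<subseteq> X" using sub by auto
    show "(\<Union>k\<in>W \<times> Z. cell k) \<in> sets lborel"
      unfolding cell_def by (simp add: open_UN)
    have "torus_box \<in> fmeasurable (lborel :: (real ^ 'n) measure)"
      by (intro fmeasurableI) (auto simp: torus_box_sets emeasure_torus_box)
    then show "X \<in> fmeasurable lborel"
      using X by (auto intro: fmeasurableI2)
  qed
  finally have "real (card (W \<times> Z)) * h ^ CARD('n) \<le> measure lborel X"
    by (simp add: meas)
  moreover have "real (card (W \<times> Z)) = real (card W) * of_int L ^ CARD('n)"
    using pos by (simp add: card_cartesian_product Z_def card_funcsetE)
  moreover have "h ^ CARD('n) = (2 * pi) ^ CARD('n) / (of_int L ^ CARD('n) * of_int p ^ CARD('n))"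
    by (simp add: h_def power_divide power_mult_distrib)
  ultimately have "real (card W) / of_int p ^ CARD('n) * (2 * pi) ^ CARD('n) \<le> measure lborel X"
    using pos by (simp add: field_simps)
  then show ?thesis
    unfolding measure_torus_measure[OF X] by (simp add: pos_le_divide_eq)
qed

section \<open>Coherence of the exponential sums\<close>

text \<open>
  The frequency \<open>\<kappa> (V + l)\<close>: the lattice vector \<open>l\<close> moved to the centre \<open>V\<close> and dilated by \<open>\<kappa>\<close>.
\<close>

definition shifted_freq :: "int \<Rightarrow> ('n \<Rightarrow> int) \<Rightarrow> ('n \<Rightarrow> int) \<Rightarrow> int ^ 'n::finite" where
  "shifted_freq \<kappa> V l = (\<chi> i. \<kappa> * (V i + l i))"

lemma norm_freq_shifted:
  "(norm (freq (shifted_freq \<kappa> V l)))\<^sup>2 =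
     (of_int \<kappa>)\<^sup>2 * of_int (idot V V + idot l l + 2 * idot l V)"
proof -
  have "(norm (freq (shifted_freq \<kappa> V l)))\<^sup>2 = (\<Sum>i\<in>UNIV. (of_int \<kappa>)\<^sup>2 * of_int ((V i + l i)\<^sup>2))"
    unfolding power2_norm_eq_inner inner_vec_def
    by (intro sum.cong refl) (simp add: freq_def shifted_freq_def power2_eq_square)
  also have "\<dots> = (of_int \<kappa>)\<^sup>2 * of_int (\<Sum>i\<in>UNIV. (V i + l i)\<^sup>2)"
    by (simp only: sum_distrib_left of_int_sum)
  also have "(\<Sum>i\<in>UNIV. (V i + l i)\<^sup>2) = idot V V + idot l l + 2 * idot l V"
    by (simp add: idot_def sum.distrib sum_distrib_left power2_eq_square algebra_simps)
  finally show ?thesis .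
qed

text \<open>
  At \<open>x = 2\<pi> (u + \<theta>) / (\<kappa> p\<^sup>2)\<close> and \<open>t = 2\<pi> j / (p\<^sup>2 \<kappa>\<^sup>2)\<close>, with \<open>u\<close> an integer vector in the plane spanned by
  \<open>\<xi>\<close> and \<open>V\<close> modulo \<open>p\<close> and \<open>j\<close> its focusing time, the phase of the frequency \<open>\<kappa> (V + l)\<close> is a constant
  independent of \<open>l\<close>, plus a multiple of \<open>2\<pi>\<close>, plus the error \<open>2\<pi> (l \<bullet> \<theta>) / p\<^sup>2\<close>. The latter is at most \<open>\<pi>/3\<close>
  by the size conditions, so there is no cancellation.
\<close>

lemma focusing:
  fixes p \<kappa> :: int and N Q :: nat and \<xi> V r :: "'n::finite \<Rightarrow> int" and x :: "real ^ 'n"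
  assumes p: "prime p" "p > 2" and xi: "p^2 dvd idot \<xi> \<xi>" and V: "\<not> p dvd idot V \<xi>"
    and S: "S \<subseteq> null_lattice p \<xi>" "\<And>l i. l \<in> S \<Longrightarrow> \<bar>l i\<bar> \<le> int N"
    and small: "6 * CARD('n) * N * Q \<le> nat p ^ 2" and kappa: "\<kappa> > 0"
    and r: "\<And>i. r i \<in> {0..<int Q}"
    and x: "\<And>i. p dvd \<lfloor>x $ i * of_int (\<kappa> * p * p) / (2 * pi)\<rfloor> - (a * \<xi> i + b * V i + r i)"
  obtains j :: int where "1 \<le> j" "j \<le> p\<^sup>2"
    "real (card S) / 2 \<le> norm (\<Sum>l\<in>S. cis (freq (shifted_freq \<kappa> V l) \<bullet> x
        - 2 * pi * of_int j / ((of_int p)\<^sup>2 * (of_int \<kappa>)\<^sup>2) * (norm (freq (shifted_freq \<kappa> V l)))\<^sup>2))"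
proof -
  define u where "u = (\<lambda>i. \<lfloor>x $ i * of_int (\<kappa> * p * p) / (2 * pi)\<rfloor> - r i)"
  define \<theta> where "\<theta> = (\<lambda>i. x $ i * of_int (\<kappa> * p * p) / (2 * pi) - of_int (u i))"
  have theta: "\<bar>\<theta> i\<bar> \<le> real Q" for i
  proof -
    have "0 \<le> r i" "r i + 1 \<le> int Q"
      using r[of i] by auto
    then have "0 \<le> real_of_int (r i)" "real_of_int (r i) + 1 \<le> real Q"
      by linarith+
    then show ?thesis
      unfolding \<theta>_def u_def of_int_diff by linarith
  qed
  have pos: "0 < real_of_int p" "0 < real_of_int \<kappa>"
    using p kappa by simp_all
  have xu: "x $ i = 2 * pi * (of_int (u i) + \<theta> i) / (of_int \<kappa> * (of_int p)\<^sup>2)" for i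
    using pos by (simp add: \<theta>_def power2_eq_square)
  have "p dvd u i - (a * \<xi> i + b * V i)" for i
    using x[of i] by (simp add: u_def algebra_simps)
  then obtain j where j: "1 \<le> j" "j \<le> p^2"
    "\<And>l. l \<in> null_lattice p \<xi> \<Longrightarrow> p^2 dvd idot l u - j * (idot l l + 2 * idot l V)"
    using exists_focusing_time[OF p xi V] by blast
  define ph where "ph = (\<lambda>l. freq (shifted_freq \<kappa> V l) \<bullet> x
        - 2 * pi * of_int j / ((of_int p)\<^sup>2 * (of_int \<kappa>)\<^sup>2) * (norm (freq (shifted_freq \<kappa> V l)))\<^sup>2)"
  define c where "c = 2 * pi / (of_int p)\<^sup>2 * ((\<Sum>i\<in>UNIV. of_int (V i) * (of_int (u i) + \<theta> i)) - of_int (j * idot V V))"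
  define \<epsilon> where "\<epsilon> = (\<lambda>l::'n \<Rightarrow> int. 2 * pi / (of_int p)\<^sup>2 * (\<Sum>i\<in>UNIV. of_int (l i) * \<theta> i))"
  have ph: "cis (ph l) = cis c * cis (\<epsilon> l)" if l: "l \<in> S" for l
  proof -
    obtain m where m: "idot l u - j * (idot l l + 2 * idot l V) = p^2 * m"
      using j(3)[of l] S(1) l by (auto elim: dvdE)
    have "freq (shifted_freq \<kappa> V l) \<bullet> x
        = (\<Sum>i\<in>UNIV. 2 * pi / (of_int p)\<^sup>2 * ((of_int (V i) + of_int (l i)) * (of_int (u i) + \<theta> i)))"
      unfolding inner_vec_def
      using pos by (intro sum.cong refl) (simp add: freq_def shifted_freq_def xu field_simps)
    also have "\<dots> = 2 * pi / (of_int p)\<^sup>2 * (\<Sum>i\<in>UNIV. (of_int (V i) + of_int (l i)) * (of_int (u i) + \<theta> i))"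
      by (simp only: sum_distrib_left)
    also have "(\<Sum>i\<in>UNIV. (of_int (V i) + of_int (l i)) * (of_int (u i) + \<theta> i))
        = (\<Sum>i\<in>UNIV. of_int (V i) * (of_int (u i) + \<theta> i)) + of_int (idot l u) + (\<Sum>i\<in>UNIV. of_int (l i) * \<theta> i)"
      by (simp add: idot_def sum.distrib algebra_simps)
    finally have 1: "freq (shifted_freq \<kappa> V l) \<bullet> x = 2 * pi / (of_int p)\<^sup>2 *
        ((\<Sum>i\<in>UNIV. of_int (V i) * (of_int (u i) + \<theta> i)) + of_int (idot l u) + (\<Sum>i\<in>UNIV. of_int (l i) * \<theta> i))" .
    have 2: "2 * pi * of_int j / ((of_int p)\<^sup>2 * (of_int \<kappa>)\<^sup>2) * (norm (freq (shifted_freq \<kappa> V l)))\<^sup>2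
        = 2 * pi / (of_int p)\<^sup>2 * of_int (j * (idot V V + idot l l + 2 * idot l V))"
      using pos unfolding norm_freq_shifted by simp
    have "ph l = 2 * pi / (of_int p)\<^sup>2 * of_int (idot l u - j * (idot l l + 2 * idot l V)) + c + \<epsilon> l"
      unfolding ph_def 1 2 c_def \<epsilon>_def by (simp add: algebra_simps)
    also have "2 * pi / (of_int p)\<^sup>2 * of_int (idot l u - j * (idot l l + 2 * idot l V)) = 2 * pi * real_of_int m"
      unfolding m using pos by simp
    finally show ?thesis
      by (simp add: cis_mult[symmetric])
  qed
  have eps: "cos (\<epsilon> l) \<ge> 1 / 2" if l: "l \<in> S" for l
  proof -
    have "\<bar>\<Sum>i\<in>UNIV. of_int (l i) * \<theta> i\<bar> \<le> (\<Sum>i\<in>(UNIV :: 'n set). real N * real Q)"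
    proof (rule order.trans[OF sum_abs sum_mono])
      fix i
      have "\<bar>of_int (l i) :: real\<bar> \<le> real N"
        using S(2)[OF l, of i] by linarith
      then show "\<bar>of_int (l i) * \<theta> i\<bar> \<le> real N * real Q"
        unfolding abs_mult using theta[of i] by (intro mult_mono) auto
    qed
    also have "\<dots> = real (CARD('n) * N * Q)"
      by simp
    finally have 1: "\<bar>\<Sum>i\<in>UNIV. of_int (l i) * \<theta> i\<bar> \<le> real (CARD('n) * N * Q)" .
    have "real (6 * CARD('n) * N * Q) \<le> real (nat p ^ 2)"
      using small by (simp only: of_nat_le_iff)
    then have "6 * real (CARD('n) * N * Q) \<le> (of_int p)\<^sup>2"
      using p by (simp add: mult.assoc)
    with 1 have "6 * \<bar>\<Sum>i\<in>UNIV. of_int (l i) * \<theta> i\<bar> \<le> (of_int p)\<^sup>2"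
      by linarith
    then have "\<bar>\<epsilon> l\<bar> \<le> 2 * pi / (of_int p)\<^sup>2 * ((of_int p)\<^sup>2 / 6)"
      unfolding \<epsilon>_def abs_mult by (intro mult_mono) auto
    then have "\<bar>\<epsilon> l\<bar> \<le> pi / 3"
      using pos by simp
    then have "cos (pi / 3) \<le> cos \<bar>\<epsilon> l\<bar>"
      by (intro cos_monotone_0_pi_le) auto
    then show ?thesis
      by (simp add: cos_60)
  qed
  have "real (card S) / 2 = (\<Sum>l\<in>S. 1 / 2)"
    by simp
  also have "\<dots> \<le> (\<Sum>l\<in>S. cos (\<epsilon> l))"
    by (intro sum_mono eps)
  also have "\<dots> = Re (\<Sum>l\<in>S. cis (\<epsilon> l))"
    by simp
  also have "\<dots> \<le> norm (\<Sum>l\<in>S. cis (\<epsilon> l))"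
    by (rule complex_Re_le_cmod)
  also have "\<dots> = norm (cis c * (\<Sum>l\<in>S. cis (\<epsilon> l)))"
    by (simp add: norm_mult)
  also have "cis c * (\<Sum>l\<in>S. cis (\<epsilon> l)) = (\<Sum>l\<in>S. cis (ph l))"
    unfolding sum_distrib_left by (intro sum.cong refl) (simp add: ph)
  finally show ?thesis
    using that j(1,2) unfolding ph_def by blast
qed

section \<open>Choice of the dilation factor\<close>

text \<open>
  The factor \<open>\<kappa>\<close> is the least integer above \<open>X\<close>, where \<open>X powr (2 - \<alpha>) = 8 * M powr \<alpha>\<close>; the constant \<open>8\<close>
  exceeds \<open>2\<pi>\<close>. As \<open>X \<ge> 1\<close>, it is at most \<open>2 X\<close>, which costs a factor \<open>4\<close> in \<open>\<kappa> powr (2 - \<alpha>)\<close>.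
\<close>

lemma exists_dilation_factor:
  fixes M \<alpha> \<delta> :: real
  assumes M: "M \<ge> 1" and al: "0 \<le> \<alpha>" "\<alpha> < 2" and de: "0 \<le> \<delta>" "\<delta> \<le> 1"
  obtains \<kappa> :: int where "\<kappa> \<ge> 1" "2 * pi / (of_int \<kappa>)\<^sup>2 < (of_int \<kappa> * M) powr (- \<alpha>)"
    "(of_int \<kappa> * M) powr (\<delta> * (1 - \<alpha> / 2)) \<le> 32 * M powr \<delta>"
proof -
  define X where "X = (8 * M powr \<alpha>) powr (1 / (2 - \<alpha>))"
  define k where "k = real_of_int (\<lfloor>X\<rfloor> + 1)"
  have M1: "M powr \<alpha> \<ge> 1"
    using M al by (simp add: ge_one_powr_ge_zero)
  then have "X \<ge> 1"
    using al unfolding X_def by (intro ge_one_powr_ge_zero) auto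
  then have k: "X < k" "k \<le> 2 * X" "k \<ge> 1"
    unfolding k_def by linarith+
  have Xp: "X powr (2 - \<alpha>) = 8 * M powr \<alpha>"
    using al M by (simp add: X_def powr_powr)
  have lower: "8 * M powr \<alpha> < k powr (2 - \<alpha>)"
    unfolding Xp[symmetric] using k \<open>X \<ge> 1\<close> al by (intro powr_less_mono2) auto
  have "k powr (2 - \<alpha>) \<le> (2 * X) powr (2 - \<alpha>)"
    using k al by (intro powr_mono2) auto
  also have "\<dots> = 2 powr (2 - \<alpha>) * (8 * M powr \<alpha>)"
    using \<open>X \<ge> 1\<close> by (simp add: powr_mult Xp)
  also have "\<dots> \<le> 2 powr 2 * (8 * M powr \<alpha>)"
    using al by (intro mult_right_mono powr_mono) auto
  finally have upper: "k powr (2 - \<alpha>) \<le> 32 * M powr \<alpha>"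
    by simp
  have k2: "k\<^sup>2 = k powr (2 - \<alpha>) * k powr \<alpha>"
    using k by (simp flip: powr_add)
  have "2 * pi * (k * M) powr \<alpha> = 2 * pi * M powr \<alpha> * k powr \<alpha>"
    using k M by (simp add: powr_mult)
  also have "\<dots> < 8 * M powr \<alpha> * k powr \<alpha>"
    using pi_less_4 M k by (intro mult_strict_right_mono) auto
  also have "\<dots> \<le> k\<^sup>2"
    unfolding k2 using lower by (intro mult_right_mono) auto
  finally have "2 * pi / k\<^sup>2 < (k * M) powr (- \<alpha>)"
    using k M by (simp add: powr_minus divide_simps)
  moreover have "(k * M) powr (\<delta> * (1 - \<alpha> / 2)) \<le> 32 * M powr \<delta>"
  proof -
    have "(k * M) powr (\<delta> * (1 - \<alpha> / 2)) = ((k * M) powr (2 - \<alpha>)) powr (\<delta> / 2)"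
      by (simp add: powr_powr field_simps)
    also have "(k * M) powr (2 - \<alpha>) = k powr (2 - \<alpha>) * M powr (2 - \<alpha>)"
      using k M by (simp add: powr_mult)
    also have "(k powr (2 - \<alpha>) * M powr (2 - \<alpha>)) powr (\<delta> / 2)
        \<le> (32 * M powr \<alpha> * M powr (2 - \<alpha>)) powr (\<delta> / 2)"
      using upper de by (intro powr_mono2 mult_right_mono mult_nonneg_nonneg) auto
    also have "32 * M powr \<alpha> * M powr (2 - \<alpha>) = 32 * M powr 2"
      using M by (simp add: powr_add[symmetric])
    also have "(32 * M powr 2) powr (\<delta> / 2) = 32 powr (\<delta> / 2) * M powr \<delta>"
      by (simp add: powr_mult powr_powr)
    also have "\<dots> \<le> 32 powr 1 * M powr \<delta>"
      using de by (intro mult_right_mono powr_mono) auto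
    finally show ?thesis by simp
  qed
  ultimately show ?thesis
    using that[of "\<lfloor>X\<rfloor> + 1"] k by (simp add: k_def)
qed

section \<open>Frequencies that focus on a large set\<close>

lemma inj_shifted_freq:
  assumes "\<kappa> \<noteq> 0"
  shows "inj (shifted_freq \<kappa> V)"
  using assms by (auto simp: inj_def shifted_freq_def vec_eq_iff fun_eq_iff)

lemma card_plane_translates:
  fixes p :: int and Q :: nat and \<xi> v :: "'n::finite \<Rightarrow> int"
  assumes p: "p > 0"
    and sep: "\<And>a b r r'. (\<And>i. r i \<in> {0..<int Q}) \<Longrightarrow> (\<And>i. r' i \<in> {0..<int Q}) \<Longrightarrow>
       (\<And>i. p dvd a * \<xi> i + b * v i + r i - r' i) \<Longrightarrow> p dvd a \<and> p dvd b \<and> r = r'"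
  shows "nat p ^ 2 * Q ^ CARD('n) \<le> card {w \<in> (UNIV :: 'n set) \<rightarrow>\<^sub>E {0..<p}.
     \<exists>a b r. (\<forall>i. r i \<in> {0..<int Q}) \<and> (\<forall>i. p dvd w i - (a * \<xi> i + b * v i + r i))}"
    (is "_ \<le> card ?W")
proof -
  define D where "D = {0..<p} \<times> {0..<p} \<times> ((UNIV :: 'n set) \<rightarrow>\<^sub>E {0..<int Q})"
  define f where "f = (\<lambda>(a, b, r :: 'n \<Rightarrow> int) i. (a * \<xi> i + b * v i + r i) mod p)"
  have "card D \<le> card ?W"
  proof (rule card_inj_on_le)
    show "inj_on f D"
    proof (rule inj_onI)
      fix s t assume s: "s \<in> D" and t: "t \<in> D" and eq: "f s = f t"
      obtain a b r a' b' r' where st: "s = (a, b, r)" "t = (a', b', r')"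
        by (metis prod_cases3)
      have "p dvd (a - a') * \<xi> i + (b - b') * v i + r i - r' i" for i
      proof -
        have "(a * \<xi> i + b * v i + r i) mod p = (a' * \<xi> i + b' * v i + r' i) mod p"
          using fun_cong[OF eq, of i] by (simp add: f_def st)
        then have "p dvd (a * \<xi> i + b * v i + r i) - (a' * \<xi> i + b' * v i + r' i)"
          by (simp add: mod_eq_dvd_iff)
        then show ?thesis
          by (simp add: algebra_simps)
      qed
      then have "p dvd a - a' \<and> p dvd b - b' \<and> r = r'"
        using s t by (intro sep) (auto simp: D_def st PiE_iff)
      then show "s = t"
        using s t eq_if_dvd_diff[of p a a'] eq_if_dvd_diff[of p b b'] by (simp add: D_def st)
    qed
    show "f ` D \<subseteq> ?W"
    proof (rule image_subsetI)
      fix s assume s: "s \<in> D"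
      obtain a b r where st: "s = (a, b, r)"
        by (metis prod_cases3)
      have "p dvd f s i - (a * \<xi> i + b * v i + r i)" for i
        by (simp add: f_def st mod_eq_dvd_iff[symmetric])
      moreover have "f s i \<in> {0..<p}" for i
        using p by (simp add: f_def st)
      moreover have "r i \<in> {0..<int Q}" for i
        using s by (simp add: st D_def PiE_iff)
      ultimately show "f s \<in> ?W"
        by (auto simp: PiE_iff)
    qed
    show "finite ?W"
      by (rule finite_subset[of _ "(UNIV :: 'n set) \<rightarrow>\<^sub>E {0..<p}"]) (auto intro: finite_PiE)
  qed
  then show ?thesis
    by (simp add: D_def card_cartesian_product card_funcsetE power2_eq_square)
qed

lemma norm_freq_shifted_bounds:
  fixes p B \<kappa> :: int and N :: nat and v :: "'n::finite \<Rightarrow> int"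
  assumes "\<kappa> > 0" "p > 0" "B \<ge> 0" and v: "\<And>i. v i \<in> {0..<p}" and l: "\<And>i. \<bar>l i\<bar> \<le> int N"
  shows "\<bar>norm (freq (shifted_freq \<kappa> (\<lambda>i. v i + (if i = i0 then p * B else 0)) l)) - of_int (\<kappa> * (p * B))\<bar>
     \<le> of_int (\<kappa> * (int CARD('n) * (p + int N)))"
proof -
  define c :: "real ^ 'n" where "c = of_int (\<kappa> * (p * B)) *\<^sub>R axis i0 1"
  let ?f = "freq (shifted_freq \<kappa> (\<lambda>i. v i + (if i = i0 then p * B else 0)) l)"
  have "norm (?f - c) \<le> (\<Sum>i\<in>UNIV. \<bar>(?f - c) $ i\<bar>)"
    by (rule norm_le_l1_cart)
  also have "\<dots> \<le> (\<Sum>i\<in>(UNIV :: 'n set). of_int (\<kappa> * (p + int N)))"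
  proof (rule sum_mono)
    fix i
    have "(?f - c) $ i = of_int (\<kappa> * (v i + l i))"
      by (simp add: freq_def shifted_freq_def c_def axis_def algebra_simps)
    also have "\<bar>\<dots>\<bar> = of_int (\<kappa> * \<bar>v i + l i\<bar>)"
      using assms(1) by (simp add: abs_mult)
    also have "\<dots> \<le> of_int (\<kappa> * (p + int N))"
      unfolding of_int_le_iff using assms(1) v[of i] l[of i] by (intro mult_left_mono) auto
    finally show "\<bar>(?f - c) $ i\<bar> \<le> of_int (\<kappa> * (p + int N))" .
  qed
  also have "\<dots> = of_int (\<kappa> * (int CARD('n) * (p + int N)))"
    by simp
  finally have "norm (?f - c) \<le> of_int (\<kappa> * (int CARD('n) * (p + int N)))" .
  moreover have "norm c = of_int (\<kappa> * (p * B))"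
    using assms by (simp add: c_def)
  ultimately show ?thesis
    using norm_triangle_ineq3[of ?f c] by linarith
qed

text \<open>
  The vector \<open>v\<close> spanning the plane may be changed by multiples of \<open>p\<close>. Adding \<open>p * B\<close> to one entry moves
  the frequencies into a ball around a point at distance \<open>\<kappa> p B\<close> from the origin. The last conclusion
  bounds from below the measure of every Borel set that contains all points at which, at one of the
  focusing times, at most half of the sum is lost.
\<close>

lemma exists_focusing_frequencies:
  fixes p \<iota> \<kappa> B :: int and N Q :: nat
  assumes p: "prime p" "p > 2" and iota: "p^2 dvd \<iota>^2 + 1"
    and d: "CARD('n::finite) \<ge> 2"
    and Q: "Q \<ge> 1" "2 * ((2 * Q - 1) ^ CARD('n) - 1) \<le> nat p ^ (CARD('n) - 2)"
    and small: "6 * CARD('n) * N * Q \<le> nat p ^ 2"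
    and kappa: "\<kappa> > 0" and B: "B \<ge> 0"
  obtains S :: "(int ^ 'n::finite) set" where
    "finite S" "(N + 1) ^ CARD('n) \<le> card S * nat p ^ CARD('n)"
    "\<And>n. n \<in> S \<Longrightarrow> \<bar>norm (freq n) - of_int (\<kappa> * (p * B))\<bar> \<le> of_int (\<kappa> * (int CARD('n) * (p + int N)))"
    "\<And>X. X \<in> sets borel \<Longrightarrow> X \<subseteq> torus_box \<Longrightarrow>
       (\<And>x j. x \<in> torus_box \<Longrightarrow> 1 \<le> j \<Longrightarrow> j \<le> p\<^sup>2 \<Longrightarrow>
          real (card S) / 2 \<le> norm (\<Sum>n\<in>S. cis (freq n \<bullet> x
             - 2 * pi * of_int j / ((of_int p)\<^sup>2 * (of_int \<kappa>)\<^sup>2) * (norm (freq n))\<^sup>2)) \<Longrightarrow> x \<in> X) \<Longrightarrow>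
       real (nat p ^ 2 * Q ^ CARD('n)) / of_int p ^ CARD('n) \<le> measure torus_measure X"
proof -
  have pp: "p > 0" using p by simp
  obtain \<xi> v :: "'n \<Rightarrow> int" and k
    where xi: "p^2 dvd idot \<xi> \<xi>" "\<not> p dvd \<xi> k" and v: "\<And>i. v i \<in> {0..<p}" "\<not> p dvd idot v \<xi>"
    and sep: "\<And>a b r r'. (\<And>i. r i \<in> {0..<int Q}) \<Longrightarrow> (\<And>i. r' i \<in> {0..<int Q}) \<Longrightarrow>
       (\<And>i. p dvd a * \<xi> i + b * v i + r i - r' i) \<Longrightarrow> p dvd a \<and> p dvd b \<and> r = r'"
    using exists_separated_plane[OF p iota d Q] by metis
  obtain S0 where S0: "finite S0" "S0 \<subseteq> null_lattice p \<xi>" "\<And>x i. x \<in> S0 \<Longrightarrow> \<bar>x i\<bar> \<le> int N"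
    "(N + 1) ^ CARD('n) \<le> card S0 * nat p ^ CARD('n)"
    using exists_short_null_vectors[of p \<xi> k N, OF p(1) xi(2)] by metis
  define V where "V = (\<lambda>i. v i + (if i = k then p * B else 0))"
  have Vv: "p dvd V i - v i" for i
    by (simp add: V_def)
  have V: "\<not> p dvd idot V \<xi>"
  proof
    assume "p dvd idot V \<xi>"
    moreover have "idot V \<xi> = idot v \<xi> + idot (\<lambda>i. V i - v i) \<xi>"
      by (simp add: idot_def algebra_simps flip: sum.distrib)
    ultimately show False
      using v(2) dvd_idot[of p "\<lambda>i. V i - v i" \<xi>, OF Vv] by (simp add: dvd_add_left_iff)
  qed
  define S where "S = shifted_freq \<kappa> V ` S0"
  have inj: "inj_on (shifted_freq \<kappa> V) S0"
    using inj_shifted_freq[of \<kappa> V] kappa by (auto intro: inj_on_subset)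
  have cardS: "card S = card S0"
    by (simp add: S_def card_image inj)
  define W where "W = {w \<in> (UNIV :: 'n set) \<rightarrow>\<^sub>E {0..<p}.
     \<exists>a b r. (\<forall>i. r i \<in> {0..<int Q}) \<and> (\<forall>i. p dvd w i - (a * \<xi> i + b * v i + r i))}"
  have finW: "finite W"
    unfolding W_def by (rule finite_subset[of _ "(UNIV :: 'n set) \<rightarrow>\<^sub>E {0..<p}"]) (auto intro: finite_PiE)
  have cardW: "nat p ^ 2 * Q ^ CARD('n) \<le> card W"
    unfolding W_def by (rule card_plane_translates[OF pp sep])
  show ?thesis
  proof (rule that[of S])
    show "finite S"
      using S0 by (simp add: S_def)
    show "(N + 1) ^ CARD('n) \<le> card S * nat p ^ CARD('n)"
      using S0(4) by (simp add: cardS)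
    show "\<bar>norm (freq n) - of_int (\<kappa> * (p * B))\<bar> \<le> of_int (\<kappa> * (int CARD('n) * (p + int N)))"
      if "n \<in> S" for n
      using that norm_freq_shifted_bounds[OF kappa pp B v(1) S0(3)] by (auto simp: S_def V_def)
    fix X :: "(real ^ 'n) set"
    assume X: "X \<in> sets borel" "X \<subseteq> torus_box"
      and contains: "\<And>x j. x \<in> torus_box \<Longrightarrow> 1 \<le> j \<Longrightarrow> j \<le> p\<^sup>2 \<Longrightarrow>
          real (card S) / 2 \<le> norm (\<Sum>n\<in>S. cis (freq n \<bullet> x
             - 2 * pi * of_int j / ((of_int p)\<^sup>2 * (of_int \<kappa>)\<^sup>2) * (norm (freq n))\<^sup>2)) \<Longrightarrow> x \<in> X"
    have "real (card W) / of_int p ^ CARD('n) \<le> measure torus_measure X"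
    proof (rule measure_ge_grid_cells[where L = "\<kappa> * p"])
      fix x :: "real ^ 'n"
      assume x: "x \<in> torus_box" and xW: "(\<lambda>i. \<lfloor>x $ i * of_int (\<kappa> * p * p) / (2 * pi)\<rfloor> mod p) \<in> W"
      obtain a b r where r: "\<And>i. r i \<in> {0..<int Q}"
        and ab: "\<And>i. p dvd \<lfloor>x $ i * of_int (\<kappa> * p * p) / (2 * pi)\<rfloor> mod p - (a * \<xi> i + b * v i + r i)"
        using xW unfolding W_def by blast
      have "p dvd \<lfloor>x $ i * of_int (\<kappa> * p * p) / (2 * pi)\<rfloor> - (a * \<xi> i + b * V i + r i)" for i
      proof -
        let ?w = "\<lfloor>x $ i * of_int (\<kappa> * p * p) / (2 * pi)\<rfloor>"
        have "?w - (a * \<xi> i + b * V i + r i)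
            = (?w - ?w mod p) + (?w mod p - (a * \<xi> i + b * v i + r i)) - b * (V i - v i)"
          by (simp add: algebra_simps)
        moreover have "p dvd ?w - ?w mod p"
          by (rule dvd_minus_mod)
        ultimately show ?thesis
          using ab[of i] Vv[of i] by (metis dvd_add dvd_diff dvd_mult)
      qed
      note cong = this
      obtain j where "1 \<le> j" "j \<le> p\<^sup>2"
        "real (card S0) / 2 \<le> norm (\<Sum>l\<in>S0. cis (freq (shifted_freq \<kappa> V l) \<bullet> x
        - 2 * pi * of_int j / ((of_int p)\<^sup>2 * (of_int \<kappa>)\<^sup>2) * (norm (freq (shifted_freq \<kappa> V l)))\<^sup>2))"
        by (rule focusing[where r = r and x = x and a = a and b = b, OF p xi(1) V S0(2) _ small kappa])
          (use S0(3) r cong in blast)+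
      then show "x \<in> X"
        using x by (intro contains[of x j]) (simp_all add: cardS, simp add: S_def sum.reindex[OF inj])
    qed (use pp kappa finW X in \<open>auto simp: W_def PiE_iff\<close>)
    moreover have "real (nat p ^ 2 * Q ^ CARD('n)) / of_int p ^ CARD('n) \<le> real (card W) / of_int p ^ CARD('n)"
      using cardW pp by (intro divide_right_mono) (simp_all only: of_nat_le_iff, simp)
    ultimately show "real (nat p ^ 2 * Q ^ CARD('n)) / of_int p ^ CARD('n) \<le> measure torus_measure X"
      by linarith
  qed
qed

section \<open>Numerical bounds for the parameters\<close>

text \<open>
  The largest admissible \<open>Q\<close> satisfies matching upper and lower bounds of order \<open>P powr (1 - 2/d)\<close>, stated
  for \<open>Q^d\<close> to avoid real exponents.
\<close>

lemma exists_maximal_box_side: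
  fixes P d :: nat
  assumes "d \<ge> 2" "P \<ge> 1"
  obtains Q where "Q \<ge> 1" "2 * ((2 * Q - 1) ^ d - 1) \<le> P ^ (d - 2)"
    "P ^ (d - 2) \<le> 2 * (3 * Q) ^ d" "Q ^ d \<le> 2 * P ^ (d - 2)"
proof -
  define good where "good = (\<lambda>Q. Q \<ge> 1 \<and> 2 * ((2 * Q - 1) ^ d - 1) \<le> P ^ (d - 2))"
  have bound: "Q \<le> P" if "good Q" for Q
    using le_of_short_box[of d P Q] that assms by (auto simp: good_def)
  define Q where "Q = (GREATEST Q. good Q)"
  have "good 1"
    by (simp add: good_def)
  then have Q: "good Q"
    unfolding Q_def by (rule GreatestI_nat[where b = P]) (use bound in auto)
  have "\<not> good (Suc Q)"
  proof
    assume "good (Suc Q)"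
    then have "Suc Q \<le> Q"
      unfolding Q_def by (rule Greatest_le_nat[where b = P]) (use bound in auto)
    then show False by simp
  qed
  then have "P ^ (d - 2) \<le> 2 * (2 * Q + 1) ^ d"
    by (simp add: good_def)
  also have "\<dots> \<le> 2 * (3 * Q) ^ d"
    using Q by (intro mult_left_mono power_mono) (auto simp: good_def)
  finally have 1: "P ^ (d - 2) \<le> 2 * (3 * Q) ^ d" .
  have "Q ^ d \<le> (2 * Q - 1) ^ d"
    using Q by (intro power_mono) (auto simp: good_def)
  moreover have "1 \<le> P ^ (d - 2)"
    using assms by simp
  ultimately have "Q ^ d \<le> 2 * P ^ (d - 2)"
    using Q unfolding good_def by linarith
  then show ?thesis
    using that[of Q] 1 Q by (simp add: good_def)
qed

text \<open>
  The frequency scale \<open>M\<close> is at most a constant times \<open>P\<^sup>2/Q\<close>, because \<open>N\<close> and \<open>P\<close> are; with the lower bound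
  for \<open>Q\<close> this gives that \<open>M^d\<close> is at most a constant times \<open>P^(d+2)\<close>.
\<close>

lemma frequency_scale_bound:
  fixes P Q d N :: nat and M :: real
  assumes d: "d \<ge> 2" and P: "P \<ge> 1" and Q: "P ^ (d - 2) \<le> 2 * (3 * Q) ^ d" "Q ^ d \<le> 2 * P ^ (d - 2)"
    and N: "6 * d * N * Q \<le> P ^ 2"
    and M: "1 \<le> M" "M \<le> 5 * real d * (real P + real N)"
  shows "M powr (real d / (real d + 2)) \<le> 2 * (45 * real d) ^ d * real P"
proof -
  have "Q ^ d \<le> 2 ^ d * P ^ d"
  proof -
    have "(2::nat) ^ 1 \<le> 2 ^ d"
      using d by (intro power_increasing) auto
    moreover have "P ^ (d - 2) \<le> P ^ d"
      using P by (intro power_increasing) auto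
    ultimately have "2 * P ^ (d - 2) \<le> 2 ^ d * P ^ d"
      by (intro mult_mono) auto
    then show ?thesis
      using Q(2) by linarith
  qed
  then have "Q ^ d \<le> (2 * P) ^ d"
    by (simp add: power_mult_distrib)
  then have "Q \<le> 2 * P"
    using d by (subst (asm) power_mono_iff) auto
  then have PQ: "P * Q \<le> 2 * P ^ 2"
    by (simp add: power2_eq_square)
  have "1 * (N * Q) \<le> (6 * d) * (N * Q)"
    using d by (intro mult_right_mono) auto
  then have NQ: "N * Q \<le> P ^ 2"
    using N by (simp only: mult_1 mult.assoc)
  have "M * real Q \<le> 5 * real d * (real P + real N) * real Q"
    using M(2) by (intro mult_right_mono) auto
  also have "\<dots> = 5 * real d * real (P * Q + N * Q)"
    by (simp add: algebra_simps)
  also have "\<dots> \<le> 5 * real d * real (3 * P ^ 2)"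
    using PQ NQ by (intro mult_left_mono of_nat_mono) auto
  finally have "M * real Q \<le> 15 * real d * real P ^ 2"
    by simp
  then have MQ: "(M * real Q) ^ d \<le> (15 * real d * real P ^ 2) ^ d"
    using M(1) by (intro power_mono) auto
  have "real (P ^ (d - 2)) \<le> real (2 * (3 * Q) ^ d)"
    using Q(1) by (simp only: of_nat_le_iff)
  then have "M ^ d * real P ^ (d - 2) \<le> M ^ d * (2 * (3 * real Q) ^ d)"
    using M(1) by (intro mult_left_mono) auto
  also have "\<dots> = 2 * 3 ^ d * (M * real Q) ^ d"
    by (simp add: power_mult_distrib)
  also have "\<dots> \<le> 2 * 3 ^ d * (15 * real d * real P ^ 2) ^ d"
    using MQ by (intro mult_left_mono) auto
  also have "\<dots> = 2 * (3 * (15 * real d)) ^ d * (real P ^ 2) ^ d"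
    by (simp only: power_mult_distrib mult_ac)
  also have "(real P ^ 2) ^ d = real P ^ (d + 2) * real P ^ (d - 2)"
  proof -
    have "2 * d = (d + 2) + (d - 2)"
      using d by simp
    then show ?thesis
      by (metis power_add power_mult)
  qed
  finally have "M ^ d * real P ^ (d - 2) \<le> (2 * (45 * real d) ^ d * real P ^ (d + 2)) * real P ^ (d - 2)"
    by (simp add: mult_ac)
  then have Md: "M ^ d \<le> 2 * (45 * real d) ^ d * real P ^ (d + 2)"
    using P by (subst (asm) mult_le_cancel_right) auto
  define C where "C = 2 * (45 * real d) ^ d"
  have "1 \<le> (45 * real d) ^ d"
    using d by (intro one_le_power) auto
  then have C: "C \<ge> 1"
    by (simp add: C_def)
  have "M powr (real d / (real d + 2)) = (M powr real d) powr (1 / (real d + 2))"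
    by (simp add: powr_powr)
  also have "\<dots> = (M ^ d) powr (1 / (real d + 2))"
    using M(1) by (simp add: powr_realpow)
  also have "\<dots> \<le> (C * real P ^ (d + 2)) powr (1 / (real d + 2))"
    using Md M(1) by (intro powr_mono2) (auto simp: C_def)
  also have "\<dots> = C powr (1 / (real d + 2)) * (real P powr real (d + 2)) powr (1 / (real d + 2))"
    using C P powr_realpow[of "real P" "d + 2"] by (simp only: powr_mult)
  also have "\<dots> = C powr (1 / (real d + 2)) * real P"
  proof -
    have "real (d + 2) * (1 / (real d + 2)) = 1"
      by simp
    then show ?thesis
      using P by (simp only: powr_powr) simp
  qed
  also have "\<dots> \<le> C powr 1 * real P"
    using C d by (intro mult_right_mono powr_mono) auto
  finally show ?thesis
    using C by (simp add: C_def)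
qed

text \<open>
  The number \<open>K\<close> of frequencies is at least of order \<open>P\<^sup>2\<close>.
\<close>

lemma frequency_count_bound:
  fixes P Q d N K :: nat
  assumes d: "d \<ge> 2" and P: "P \<ge> 1" and Q: "Q ^ d \<le> 2 * P ^ (d - 2)"
    and N: "P ^ 2 \<le> (N + 1) * (6 * d * Q)" and K: "(N + 1) ^ d \<le> K * P ^ d"
  shows "P ^ 2 \<le> 2 * (6 * d) ^ d * K"
proof -
  have "(P ^ 2) ^ d \<le> ((N + 1) * (6 * d * Q)) ^ d"
    by (intro power_mono N) auto
  also have "\<dots> = (N + 1) ^ d * ((6 * d) ^ d * Q ^ d)"
    by (simp only: power_mult_distrib)
  also have "\<dots> \<le> (K * P ^ d) * ((6 * d) ^ d * (2 * P ^ (d - 2)))"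
    by (intro mult_mono K Q order_refl) auto
  also have "\<dots> = (2 * (6 * d) ^ d * K) * (P ^ d * P ^ (d - 2))"
    by (simp only: mult_ac)
  finally have "(P ^ 2) ^ d \<le> (2 * (6 * d) ^ d * K) * (P ^ d * P ^ (d - 2))" .
  moreover have "(P ^ 2) ^ d = P ^ 2 * (P ^ d * P ^ (d - 2))"
  proof -
    have "2 * d = 2 + (d + (d - 2))"
      using d by simp
    then show ?thesis
      by (metis power_add power_mult)
  qed
  ultimately show ?thesis
    using P by simp
qed

section \<open>Concentration on a set of positive measure\<close>

theorem corollary4p1:
  assumes "CARD('n::finite) \<ge> 2"
  shows "\<exists>b::real. b > 0 \<and>
    (\<forall>\<alpha>::real. 0 \<le> \<alpha> \<and> \<alpha> < 2 \<longrightarrow>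
      (\<exists>c::real. c > 0 \<and>
        (\<forall>M\<^sub>0::real. \<exists>M::real. M > M\<^sub>0 \<and> M > 0 \<and>
          (\<exists>G :: real ^ 'n \<Rightarrow> complex.
             trig_polynomial G \<and>
             torus_L2_norm G = 1 \<and>
             fourier_support G \<subseteq> {n. M \<le> norm (freq n) \<and> norm (freq n) \<le> 2 * M} \<and>
             measure torus_measure
               {x \<in> torus_box.
                  (SUP t\<in>{0<..<M powr (- \<alpha>)}. norm (schroedinger t G x))
                    \<ge> c * M powr (real CARD('n) / (real CARD('n) + 2) * (1 - \<alpha> / 2))}
               \<ge> b))))"
proof -
  define d where "d = CARD('n)"
  have d: "d \<ge> 2" using assms by (simp add: d_def)
  define b :: real where "b = 1 / (2 * 3 ^ d)"
  define C0 :: real where "C0 = 2 * (45 * real d) ^ d"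
  define C1 :: real where "C1 = 2 * (6 * real d) ^ d"
  have C: "C0 > 0" "C1 > 0"
    using d by (auto simp: C0_def C1_def)
  define c where "c = 1 / (64 * C0 * sqrt C1)"
  have c: "c > 0" using C by (simp add: c_def)
  have "\<exists>M::real. M > M0 \<and> M > 0 \<and>
          (\<exists>G :: real ^ 'n \<Rightarrow> complex.
             trig_polynomial G \<and>
             torus_L2_norm G = 1 \<and>
             fourier_support G \<subseteq> {n. M \<le> norm (freq n) \<and> norm (freq n) \<le> 2 * M} \<and>
             measure torus_measure
               {x \<in> torus_box.
                  (SUP t\<in>{0<..<M powr (- \<alpha>)}. norm (schroedinger t G x))
                    \<ge> c * M powr (real d / (real d + 2) * (1 - \<alpha> / 2))}
               \<ge> b)"
    if al: "0 \<le> \<alpha>" "\<alpha> < 2" for \<alpha> M0 :: real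
  proof -
    obtain p \<iota> :: int where p: "prime p" "p > max 2 \<lceil>M0\<rceil>" and iota: "p^2 dvd \<iota>^2 + 1"
      using exists_prime_sqrt_minus_one by metis
    have p2: "p > 2" and pM0: "M0 < of_int p"
      using p(2) by linarith+
    define P where "P = nat p"
    have P: "P \<ge> 1" "int P = p" "real P = of_int p"
      using p2 by (auto simp: P_def)
    obtain Q where Q: "Q \<ge> 1" "2 * ((2 * Q - 1) ^ d - 1) \<le> P ^ (d - 2)"
      "P ^ (d - 2) \<le> 2 * (3 * Q) ^ d" "Q ^ d \<le> 2 * P ^ (d - 2)"
      using exists_maximal_box_side[OF d P(1)] by metis
    define N where "N = P ^ 2 div (6 * d * Q)"
    have N1: "6 * d * N * Q \<le> P ^ 2"
      using times_div_less_eq_dividend[of "6 * d * Q" "P ^ 2"] by (simp add: N_def mult_ac)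
    have "0 < 6 * d * Q"
      using d Q(1) by simp
    then have N2: "P ^ 2 \<le> (N + 1) * (6 * d * Q)"
      using dividend_less_div_times[of "6 * d * Q" "P ^ 2"] by (simp add: N_def)
    \<comment> \<open>The undilated frequencies lie within \<open>\<Delta>\<close> of a point at distance \<open>p * B\<close> from the origin.\<close>
    \<comment> \<open>As \<open>3 * \<Delta> \<le> p * B\<close>, they lie in the annulus between \<open>p * B - \<Delta>\<close> and twice this radius.\<close>
    define \<Delta> where "\<Delta> = int d * (p + int N)"
    define B where "B = 3 * int d * (2 + int N div p)"
    have B0: "B \<ge> 0"
      using p2 by (simp add: B_def pos_imp_zdiv_nonneg_iff)
    have pN: "p * (int N div p) \<le> int N" "int N < p * (int N div p) + p"
      using p2 mult_div_mod_eq[of p "int N"] pos_mod_sign[of p "int N"] pos_mod_bound[of p "int N"] by linarith+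
    have pB_eq: "p * B = 3 * int d * (2 * p + p * (int N div p))"
      by (simp add: B_def algebra_simps)
    have pB1: "3 * \<Delta> \<le> p * B"
    proof -
      have "3 * int d * (p + int N) \<le> 3 * int d * (2 * p + p * (int N div p))"
        using pN by (intro mult_left_mono) auto
      then show ?thesis by (simp add: pB_eq \<Delta>_def)
    qed
    have pB2: "p * B \<le> 6 * \<Delta>"
    proof -
      have "3 * int d * (2 * p + p * (int N div p)) \<le> 3 * int d * (2 * p + 2 * int N)"
        using pN by (intro mult_left_mono) auto
      also have "\<dots> = 6 * \<Delta>"
        by (simp add: \<Delta>_def algebra_simps)
      finally show ?thesis
        unfolding pB_eq .
    qed
    have "1 * (p + int N) \<le> \<Delta>"
      unfolding \<Delta>_def using d p2 by (intro mult_right_mono) auto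
    then have Dp: "p \<le> \<Delta>"
      by simp
    define M1 :: real where "M1 = of_int (p * B - \<Delta>)"
    have M1p: "of_int p \<le> M1"
      unfolding M1_def of_int_le_iff using pB1 Dp p2 by linarith
    have M1_1: "1 \<le> M1"
      using M1p p2 by linarith
    have "M1 \<le> of_int (5 * \<Delta>)"
      unfolding M1_def of_int_le_iff using pB2 by linarith
    also have "of_int (5 * \<Delta>) = 5 * real d * (real P + real N)"
      by (simp add: \<Delta>_def P(3))
    finally have M1_le: "M1 \<le> 5 * real d * (real P + real N)" .
    have scale: "M1 powr (real d / (real d + 2)) \<le> C0 * real P"
      unfolding C0_def by (rule frequency_scale_bound[OF d P(1) Q(3,4) N1 M1_1 M1_le])
    obtain \<kappa> :: int where \<kappa>: "\<kappa> \<ge> 1" "2 * pi / (of_int \<kappa>)\<^sup>2 < (of_int \<kappa> * M1) powr (- \<alpha>)"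
      "(of_int \<kappa> * M1) powr (real d / (real d + 2) * (1 - \<alpha> / 2)) \<le> 32 * M1 powr (real d / (real d + 2))"
      using exists_dilation_factor[OF M1_1 al, of "real d / (real d + 2)"] d by (auto simp: field_simps)
    define M where "M = of_int \<kappa> * M1"
    have "1 * M1 \<le> M"
      unfolding M_def using \<kappa>(1) M1_1 by (intro mult_right_mono) auto
    then have M: "M1 \<le> M" by simp
    have pre: "2 * ((2 * Q - 1) ^ CARD('n) - 1) \<le> nat p ^ (CARD('n) - 2)"
      "6 * CARD('n) * N * Q \<le> nat p ^ 2" "\<kappa> > 0"
      using Q(2) N1 \<kappa>(1) by (simp_all add: d_def P_def)
    note frequencies = exists_focusing_frequencies[OF p(1) p2 iota assms Q(1) pre B0,
        folded d_def P_def, folded \<Delta>_def]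
    obtain S :: "(int ^ 'n) set" where S: "finite S" "(N + 1) ^ d \<le> card S * P ^ d"
      "\<And>n. n \<in> S \<Longrightarrow> \<bar>norm (freq n) - of_int (\<kappa> * (p * B))\<bar> \<le> of_int (\<kappa> * \<Delta>)"
      "\<And>X. X \<in> sets borel \<Longrightarrow> X \<subseteq> torus_box \<Longrightarrow>
       (\<And>x j. x \<in> torus_box \<Longrightarrow> 1 \<le> j \<Longrightarrow> j \<le> p\<^sup>2 \<Longrightarrow>
          real (card S) / 2 \<le> norm (\<Sum>n\<in>S. cis (freq n \<bullet> x
             - 2 * pi * of_int j / ((of_int p)\<^sup>2 * (of_int \<kappa>)\<^sup>2) * (norm (freq n))\<^sup>2)) \<Longrightarrow> x \<in> X) \<Longrightarrow>
       real (P ^ 2 * Q ^ d) / of_int p ^ d \<le> measure torus_measure X"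
      by (fact frequencies)
    have "S \<noteq> {}"
      using S(2) by auto
    then have cS: "card S > 0"
      using S(1) by (simp add: card_gt_0_iff)
    define a where "a = 1 / sqrt (real (card S))"
    define G :: "real ^ 'n \<Rightarrow> complex" where "G = (\<lambda>x. \<Sum>n\<in>S. of_real a * cis (freq n \<bullet> x))"
    have a: "a > 0"
      using cS by (simp add: a_def)
    have G1: "trig_polynomial G"
      unfolding trig_polynomial_def G_def
      by (intro exI[of _ S] exI[of _ "\<lambda>_. of_real a"] conjI S(1) refl)
    have G2: "torus_L2_norm G = 1"
    proof -
      have "(norm (complex_of_real a))\<^sup>2 = 1 / real (card S)"
        unfolding norm_of_real by (simp add: a_def power_divide)
      then show ?thesis
        unfolding G_def torus_L2_norm_trig_sum[OF S(1)] using cS by simp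
    qed
    have G3: "fourier_support G \<subseteq> {n. M \<le> norm (freq n) \<and> norm (freq n) \<le> 2 * M}"
    proof
      fix n assume "n \<in> fourier_support G"
      then have "n \<in> S"
        by (auto simp: fourier_support_def G_def fourier_coeff_trig_sum[OF S(1)] split: if_splits)
      then have "\<bar>norm (freq n) - of_int (\<kappa> * (p * B))\<bar> \<le> of_int (\<kappa> * \<Delta>)"
        by (rule S(3))
      moreover have "M = of_int (\<kappa> * (p * B)) - of_int (\<kappa> * \<Delta>)"
        by (simp add: M_def M1_def algebra_simps)
      moreover have "3 * real_of_int (\<kappa> * \<Delta>) \<le> of_int (\<kappa> * (p * B))"
      proof -
        have "3 * (\<kappa> * \<Delta>) \<le> \<kappa> * (p * B)"
          using mult_left_mono[OF pB1, of \<kappa>] \<kappa>(1) by (simp add: mult.left_commute)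
        then show ?thesis by linarith
      qed
      ultimately show "n \<in> {n. M \<le> norm (freq n) \<and> norm (freq n) \<le> 2 * M}"
        unfolding mem_Collect_eq by (intro conjI; linarith)
    qed
    define I where "I = {0<..<M powr (- \<alpha>)}"
    define y where "y = c * M powr (real d / (real d + 2) * (1 - \<alpha> / 2))"
    define X where "X = {x \<in> torus_box. y \<le> (SUP t\<in>I. norm (schroedinger t G x))}"
    have bdd: "bdd_above ((\<lambda>t. norm (schroedinger t G x)) ` I)" for x
      unfolding G_def by (rule bdd_aboveI2) (rule norm_schroedinger_trig_sum_le[OF S(1)])
    have "I \<noteq> {}"
      using M M1_1 by (simp add: I_def)
    have "{x. y \<le> (SUP t\<in>I. norm (schroedinger t G x))} \<in> sets borel"
    proof (rule SUP_level_set_borel[OF _ bdd \<open>I \<noteq> {}\<close>])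
      show "continuous_on UNIV (\<lambda>x. norm (schroedinger t G x))" for t
        unfolding G_def schroedinger_trig_sum[OF S(1)]
        unfolding cis_conv_exp by (intro continuous_intros)
    qed
    then have X: "X \<in> sets borel" "X \<subseteq> torus_box"
      using sets.Int[OF torus_box_sets] by (auto simp: X_def Collect_conj_eq)
    have height: "y \<le> sqrt (real (card S)) / 2"
    proof -
      have "P ^ 2 \<le> 2 * (6 * d) ^ d * card S"
        by (rule frequency_count_bound[OF d P(1) Q(4) N2 S(2)])
      then have "real (P ^ 2) \<le> real (2 * (6 * d) ^ d * card S)"
        by (simp only: of_nat_le_iff)
      then have "(real P)\<^sup>2 \<le> C1 * real (card S)"
        by (simp add: C1_def)
      then have PS: "real P \<le> sqrt C1 * sqrt (real (card S))"
        unfolding real_sqrt_mult[symmetric] by (rule real_le_rsqrt)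
      have "y \<le> c * (32 * (C0 * real P))"
        unfolding y_def using \<kappa>(3) scale c by (intro mult_left_mono) (auto simp: M_def)
      also have "\<dots> = real P / (2 * sqrt C1)"
        using C by (simp add: c_def field_simps)
      also have "\<dots> \<le> sqrt C1 * sqrt (real (card S)) / (2 * sqrt C1)"
        using PS C by (intro divide_right_mono) auto
      also have "\<dots> = sqrt (real (card S)) / 2"
        using C by simp
      finally show ?thesis .
    qed
    have "real (P ^ 2 * Q ^ d) / of_int p ^ d \<le> measure torus_measure X"
    proof (rule S(4)[OF X])
      fix x :: "real ^ 'n" and j :: int
      assume x: "x \<in> torus_box" and j: "1 \<le> j" "j \<le> p\<^sup>2"
        and big: "real (card S) / 2 \<le> norm (\<Sum>n\<in>S. cis (freq n \<bullet> x
             - 2 * pi * of_int j / ((of_int p)\<^sup>2 * (of_int \<kappa>)\<^sup>2) * (norm (freq n))\<^sup>2))"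
      define t where "t = 2 * pi * of_int j / ((of_int p)\<^sup>2 * (of_int \<kappa>)\<^sup>2)"
      have "0 < t"
        using j p2 \<kappa>(1) by (simp add: t_def)
      moreover have "t < M powr (- \<alpha>)"
      proof -
        have "real_of_int j / (of_int p)\<^sup>2 \<le> 1"
          using j(2) p2 by (simp add: divide_le_eq flip: of_int_power)
        then have "2 * pi / (of_int \<kappa>)\<^sup>2 * (real_of_int j / (of_int p)\<^sup>2) \<le> 2 * pi / (of_int \<kappa>)\<^sup>2 * 1"
          by (intro mult_left_mono) auto
        then have "t \<le> 2 * pi / (of_int \<kappa>)\<^sup>2"
          by (simp add: t_def mult_ac)
        then show ?thesis
          using \<kappa>(2) by (simp add: M_def)
      qed
      ultimately have tI: "t \<in> I"
        by (simp add: I_def)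
      have "schroedinger t G x = of_real a * (\<Sum>n\<in>S. cis (freq n \<bullet> x - t * (norm (freq n))\<^sup>2))"
        unfolding G_def schroedinger_trig_sum[OF S(1)] by (simp add: sum_distrib_left)
      then have "norm (schroedinger t G x) = a * norm (\<Sum>n\<in>S. cis (freq n \<bullet> x - t * (norm (freq n))\<^sup>2))"
        using a by (simp add: norm_mult)
      also have "\<dots> \<ge> a * (real (card S) / 2)"
        using big a unfolding t_def by (intro mult_left_mono) auto
      also have "a * (real (card S) / 2) = sqrt (real (card S)) / 2"
        using cS by (simp add: a_def real_div_sqrt)
      finally have "y \<le> norm (schroedinger t G x)"
        using height by linarith
      also have "\<dots> \<le> (SUP t\<in>I. norm (schroedinger t G x))"
        by (rule cSUP_upper[OF tI bdd])
      finally show "x \<in> X"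
        using x by (simp add: X_def)
    qed
    moreover have "b \<le> real (P ^ 2 * Q ^ d) / of_int p ^ d"
    proof -
      have "real (P ^ (d - 2)) \<le> real (2 * (3 * Q) ^ d)"
        using Q(3) by (simp only: of_nat_le_iff)
      then have "real P ^ 2 * real P ^ (d - 2) \<le> real P ^ 2 * (2 * 3 ^ d * real Q ^ d)"
        by (intro mult_left_mono) (simp_all add: power_mult_distrib)
      moreover have "real P ^ 2 * real P ^ (d - 2) = real P ^ d"
        using d by (metis le_add_diff_inverse power_add)
      ultimately have "real P ^ d \<le> 2 * 3 ^ d * (real P ^ 2 * real Q ^ d)"
        by (simp add: mult_ac)
      then show ?thesis
        using P p2 unfolding b_def P(3)[symmetric] by (simp add: field_simps)
    qed
    ultimately have "b \<le> measure torus_measure X"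
      by linarith
    then show ?thesis
      using G1 G2 G3 M M1p M1_1 pM0 unfolding X_def y_def I_def
      by (intro exI[of _ M] conjI exI[of _ G]) auto
  qed
  moreover have "b > 0"
    by (simp add: b_def)
  ultimately show ?thesis
    using c unfolding d_def by blast
qed

end
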